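(* Let $(\mathcal C,\mathbb E,\mathfrak s)$ be an extriangulated category. The following statements are equivalent: (1) $\mathcal C$ is weakly idempotent complete. (2) For all morphisms $f:X\to Y$ and $g:Y\to Z$, if $gf$ is an $\mathbb E$-inflation, then so is $f$. (2)$'$ For all morphisms $f:X\to Y$ and $g:Y\to Z$, if $gf$ is an $\mathbb E$-deflation, then so is $g$. (3) The class of $\mathbb E$-inflations is closed under retracts. (3)$'$ The class of $\mathbb E$-deflations is closed under retracts. (4) For every morphism $i:X\to Y$ and every $Z\in\mathcal C$, if $\left(\begin{smallmatrix}i\\0\end{smallmatrix}\right):X\to Y\oplus Z$ is an $\mathbb E$-inflation, then so is $i$. (4)$'$ For every morphism $p:X\to Y$ and every $Z\in\mathcal C$, if $(p,0):X\oplus Z\to Y$ is an $\mathbb E$-deflation, then so is $p$. (5) ($3\times3$ Lemma) For any four $\mathbb E$-triangles $A_1\xrightarrow{f_A}A_2\xrightarrow{g_A}A_3\overset{\delta_A}{\dashrightarrow}$, $B_1\xrightarrow{f_B}B_2\xrightarrow{g_B}B_3\overset{\delta_B}{\dashrightarrow}$, $A_2\xrightarrow{i_2}B_2\xrightarrow{p_2}C_2\overset{\varepsilon_2}{\dashrightarrow}$ and $A_3\xrightarrow{i_3}B_3\xrightarrow{p_3}C_3\overset{\varepsilon_3}{\dashrightarrow}$ with $g_Bi_2=i_3g_A$, there is a $3\times3$ diagram whose first two rows and last two columns are these four $\mathbb E$-triangles; that is, there are $\mathbb E$-triangles $A_1\xrightarrow{i_1}B_1\xrightarrow{p_1}C_1\overset{\varepsilon_1}{\dashrightarrow}$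 and $C_1\xrightarrow{f_C}C_2\xrightarrow{g_C}C_3\overset{\delta_C}{\dashrightarrow}$ which together with the given four form a $3\times3$ diagram.
   Context: Extriangulated categories (Nakaoka–Palu). Let $\mathcal C$ be an additive category and $\mathbb E:\mathcal C^{\mathrm{op}}\times\mathcal C\to\mathbf{Ab}$ an additive bifunctor. An element $\delta\in\mathbb E(Z,X)$ is an $\mathbb E$-extension; write $f_*=\mathbb E(-,f)$ and $g^*=\mathbb E(g,-)$. Two sequences $X\to Y\to Z$ and $X\to Y'\to Z$ are equivalent if there is an isomorphism $Y\cong Y'$ compatible with the maps from $X$ and to $Z$. An additive realization $\mathfrak s$ assigns to each $\delta\in\mathbb E(Z,X)$ an equivalence class $\mathfrak s(\delta)=[X\xrightarrow{f}Y\xrightarrow{g}Z]$ such that: (i) if $\delta\in\mathbb E(Z,X)$, $\delta'\in\mathbb E(Z',X')$, $\alpha:X\to X'$, $\gamma:Z\to Z'$ satisfy $\alpha_*\delta=\gamma^*\delta'$, then for any representatives $X\xrightarrow{f}Y\xrightarrow{g}Z$ of $\mathfrak s(\delta)$ and $X'\xrightarrow{f'}Y'\xrightarrow{g'}Z'$ of $\mathfrak s(\delta')$ there is $\beta:Y\to Y'$ with $\beta f=f'\alpha$, $g'\beta=\gamma g$; (ii) $0\in\mathbb E(Z,X)$ is realized by the split sequence $X\to X\oplus Z\to Z$; (iii) $\mathfrak s(\delta\oplus\delta')=\mathfrak s(\delta)\oplus\mathfrak s(\delta')$. If $\mathfrak s(\delta)=[X\xrightarrow{f}Y\xrightarrow{g}Z]$,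 one writes $X\xrightarrow{f}Y\xrightarrow{g}Z\overset{\delta}{\dashrightarrow}$ and calls it an $\mathbb E$-triangle, $f$ an $\mathbb E$-inflation, $g$ an $\mathbb E$-deflation. A morphism of $\mathbb E$-triangles from this one to $X'\xrightarrow{f'}Y'\xrightarrow{g'}Z'\overset{\delta'}{\dashrightarrow}$ is a triple $(\alpha,\beta,\gamma)$ with $\beta f=f'\alpha$, $g'\beta=\gamma g$, $\alpha_*\delta=\gamma^*\delta'$. $(\mathcal C,\mathbb E,\mathfrak s)$ is an extriangulated category if moreover: (ET3) for two such $\mathbb E$-triangles and $\alpha,\beta$ with $\beta f=f'\alpha$ there is $\gamma$ making $(\alpha,\beta,\gamma)$ a morphism of $\mathbb E$-triangles; (ET3$^{\mathrm{op}}$) given $\beta,\gamma$ with $\gamma g=g'\beta$ there is $\alpha$ making $(\alpha,\beta,\gamma)$ a morphism of $\mathbb E$-triangles; (ET4) given $\mathbb E$-triangles $A\xrightarrow{f}B\xrightarrow{g}D\overset{\delta}{\dashrightarrow}$ and $B\xrightarrow{u}C\xrightarrow{v}E\overset{\varepsilon}{\dashrightarrow}$ there are $\mathbb E$-triangles $A\xrightarrow{m}C\xrightarrow{h}F\overset{\theta}{\dashrightarrow}$ and $D\xrightarrow{w}F\xrightarrow{q}E\overset{\eta}{\dashrightarrow}$ with $m=uf$, $wg=hu$, $v=qh$, $w^*\theta=\delta$, $g_*\varepsilon=\eta$, $f_*\theta=q^*\varepsilon$; (ET4$^{\mathrm{op}}$) conversely, given the latter two $\mathbb E$-triangles there are $\mathbb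 E$-triangles of the former form satisfying the same six relations. An additive category is weakly idempotent complete if every section (split monomorphism) has a cokernel, equivalently every retraction (split epimorphism) has a kernel. A morphism $f':A'\to B'$ is a retract of $f:A\to B$ if there are $i:A'\to A$, $p:A\to A'$, $j:B'\to B$, $q:B\to B'$ with $fi=jf'$, $f'p=qf$, $pi=1_{A'}$, $qj=1_{B'}$. A $3\times3$ diagram is a diagram consisting of six $\mathbb E$-triangles: three rows $A_1\xrightarrow{f_A}A_2\xrightarrow{g_A}A_3\overset{\delta_A}{\dashrightarrow}$, $B_1\xrightarrow{f_B}B_2\xrightarrow{g_B}B_3\overset{\delta_B}{\dashrightarrow}$, $C_1\xrightarrow{f_C}C_2\xrightarrow{g_C}C_3\overset{\delta_C}{\dashrightarrow}$ and three columns $A_j\xrightarrow{i_j}B_j\xrightarrow{p_j}C_j\overset{\varepsilon_j}{\dashrightarrow}$ ($j=1,2,3$), such that $(i_1,i_2,i_3)$ (row $A$ to row $B$), $(p_1,p_2,p_3)$ (row $B$ to row $C$), $(f_A,f_B,f_C)$ (column 1 to column 2) and $(g_A,g_B,g_C)$ (column 2 to column 3) are morphisms of $\mathbb E$-triangles. *)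

theory Defs
  imports "HOL-Algebra.Group"
begin

text \<open>
  Hom-groups and extension groups are records of type \<open>monoid\<close> required to be
  \<open>comm_group\<close>s; the group operation, written additively in the literature, is \<open>mult\<close>
  and the zero element is \<open>one\<close>.

  Morphisms do not carry their domain and codomain: every notion takes the objects involved as
  arguments.  Distinct hom-sets need not be disjoint; a category whose composition depends on the
  objects is covered by tagging each morphism with its domain and codomain.
\<close>

record ('o, 'm) category =
  Obj :: "'o set"
  Hom :: "'o \<Rightarrow> 'o \<Rightarrow> 'm monoid"
  comp :: "'m \<Rightarrow> 'm \<Rightarrow> 'm"  (infixl "\<cdot>\<index>" 70)
  ident :: "'o \<Rightarrow> 'm"

abbreviation arrow :: "('o, 'm, 'x) category_scheme \<Rightarrow> 'm \<Rightarrow> 'o \<Rightarrow> 'o \<Rightarrow> bool"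
  where "arrow C f X Y \<equiv> X \<in> Obj C \<and> Y \<in> Obj C \<and> f \<in> carrier (Hom C X Y)"

abbreviation zero_mor :: "('o, 'm, 'x) category_scheme \<Rightarrow> 'o \<Rightarrow> 'o \<Rightarrow> 'm"
  where "zero_mor C X Y \<equiv> one (Hom C X Y)"

abbreviation add_mor :: "('o, 'm, 'x) category_scheme \<Rightarrow> 'o \<Rightarrow> 'o \<Rightarrow> 'm \<Rightarrow> 'm \<Rightarrow> 'm"
  where "add_mor C X Y f g \<equiv> mult (Hom C X Y) f g"

locale preadditive_category =
  fixes C :: "('o, 'm, 'x) category_scheme" (structure)
  assumes hom_group: "\<lbrakk>X \<in> Obj C; Y \<in> Obj C\<rbrakk> \<Longrightarrow> comm_group (Hom C X Y)"
    and ident_closed: "X \<in> Obj C \<Longrightarrow> arrow C (ident C X) X X"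
    and comp_closed: "\<lbrakk>arrow C f X Y; arrow C g Y Z\<rbrakk> \<Longrightarrow> arrow C (g \<cdot> f) X Z"
    and comp_assoc:
      "\<lbrakk>arrow C f X Y; arrow C g Y Z; arrow C h Z W\<rbrakk> \<Longrightarrow> h \<cdot> (g \<cdot> f) = h \<cdot> g \<cdot> f"
    and comp_ident_left: "arrow C f X Y \<Longrightarrow> ident C Y \<cdot> f = f"
    and comp_ident_right: "arrow C f X Y \<Longrightarrow> f \<cdot> ident C X = f"
    and comp_add_left:
      "\<lbrakk>arrow C f X Y; arrow C g Y Z; arrow C g' Y Z\<rbrakk>
        \<Longrightarrow> add_mor C Y Z g g' \<cdot> f = add_mor C X Z (g \<cdot> f) (g' \<cdot> f)"
    and comp_add_right:
      "\<lbrakk>arrow C f X Y; arrow C f' X Y; arrow C g Y Z\<rbrakk>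
        \<Longrightarrow> g \<cdot> add_mor C X Y f f' = add_mor C X Z (g \<cdot> f) (g \<cdot> f')"

definition zero_object :: "('o, 'm, 'x) category_scheme \<Rightarrow> 'o \<Rightarrow> bool"
  where "zero_object C N \<longleftrightarrow> N \<in> Obj C \<and>
    (\<forall>X\<in>Obj C. (\<exists>!f. arrow C f X N) \<and> (\<exists>!f. arrow C f N X))"

definition biproduct ::
  "('o, 'm, 'x) category_scheme \<Rightarrow> 'o \<Rightarrow> 'o \<Rightarrow> 'o \<Rightarrow> 'm \<Rightarrow> 'm \<Rightarrow> 'm \<Rightarrow> 'm \<Rightarrow> bool"
  where "biproduct C X Y S j\<^sub>1 j\<^sub>2 q\<^sub>1 q\<^sub>2 \<longleftrightarrow>
    arrow C j\<^sub>1 X S \<and> arrow C j\<^sub>2 Y S \<and> arrow C q\<^sub>1 S X \<and> arrow C q\<^sub>2 S Y \<and>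
    q\<^sub>1 \<cdot>\<^bsub>C\<^esub> j\<^sub>1 = ident C X \<and> q\<^sub>2 \<cdot>\<^bsub>C\<^esub> j\<^sub>2 = ident C Y \<and>
    q\<^sub>2 \<cdot>\<^bsub>C\<^esub> j\<^sub>1 = zero_mor C X Y \<and> q\<^sub>1 \<cdot>\<^bsub>C\<^esub> j\<^sub>2 = zero_mor C Y X \<and>
    add_mor C S S (j\<^sub>1 \<cdot>\<^bsub>C\<^esub> q\<^sub>1) (j\<^sub>2 \<cdot>\<^bsub>C\<^esub> q\<^sub>2) = ident C S"

locale additive_category = preadditive_category +
  assumes ex_zero_object: "\<exists>N. zero_object C N"
    and ex_biproduct:
      "\<lbrakk>X \<in> Obj C; Y \<in> Obj C\<rbrakk> \<Longrightarrow> \<exists>S j\<^sub>1 j\<^sub>2 q\<^sub>1 q\<^sub>2. biproduct C X Y S j\<^sub>1 j\<^sub>2 q\<^sub>1 q\<^sub>2"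

definition isomorphism :: "('o, 'm, 'x) category_scheme \<Rightarrow> 'o \<Rightarrow> 'o \<Rightarrow> 'm \<Rightarrow> bool"
  where "isomorphism C X Y f \<longleftrightarrow> arrow C f X Y \<and>
    (\<exists>g. arrow C g Y X \<and> g \<cdot>\<^bsub>C\<^esub> f = ident C X \<and> f \<cdot>\<^bsub>C\<^esub> g = ident C Y)"

definition section_mor :: "('o, 'm, 'x) category_scheme \<Rightarrow> 'o \<Rightarrow> 'o \<Rightarrow> 'm \<Rightarrow> bool"
  where "section_mor C X Y f \<longleftrightarrow> arrow C f X Y \<and>
    (\<exists>r. arrow C r Y X \<and> r \<cdot>\<^bsub>C\<^esub> f = ident C X)"

definition cokernel :: "('o, 'm, 'x) category_scheme \<Rightarrow> 'o \<Rightarrow> 'o \<Rightarrow> 'm \<Rightarrow> 'o \<Rightarrow> 'm \<Rightarrow> bool"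
  where "cokernel C X Y f K c \<longleftrightarrow>
    arrow C f X Y \<and> arrow C c Y K \<and> c \<cdot>\<^bsub>C\<^esub> f = zero_mor C X K \<and>
    (\<forall>T t. arrow C t Y T \<and> t \<cdot>\<^bsub>C\<^esub> f = zero_mor C X T
      \<longrightarrow> (\<exists>!u. arrow C u K T \<and> u \<cdot>\<^bsub>C\<^esub> c = t))"

definition weakly_idempotent_complete :: "('o, 'm, 'x) category_scheme \<Rightarrow> bool"
  where "weakly_idempotent_complete C \<longleftrightarrow>
    (\<forall>X Y f. section_mor C X Y f \<longrightarrow> (\<exists>K c. cokernel C X Y f K c))"

text \<open>\<open>retract C A' B' f' A B f\<close>: the morphism \<open>f' : A' \<rightarrow> B'\<close> is a retract of \<open>f : A \<rightarrow> B\<close>.\<close>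

definition retract ::
  "('o, 'm, 'x) category_scheme \<Rightarrow> 'o \<Rightarrow> 'o \<Rightarrow> 'm \<Rightarrow> 'o \<Rightarrow> 'o \<Rightarrow> 'm \<Rightarrow> bool"
  where "retract C A' B' f' A B f \<longleftrightarrow> arrow C f' A' B' \<and> arrow C f A B \<and>
    (\<exists>i p j q. arrow C i A' A \<and> arrow C p A A' \<and> arrow C j B' B \<and> arrow C q B B' \<and>
      f \<cdot>\<^bsub>C\<^esub> i = j \<cdot>\<^bsub>C\<^esub> f' \<and> f' \<cdot>\<^bsub>C\<^esub> p = q \<cdot>\<^bsub>C\<^esub> f \<and>
      p \<cdot>\<^bsub>C\<^esub> i = ident C A' \<and> q \<cdot>\<^bsub>C\<^esub> j = ident C B')"

text \<open>
  \<open>Ext C Z X\<close> is the group \<open>\<bbbE>(Z, X)\<close>, and \<open>Extmap C g f\<close> is the map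
  \<open>\<bbbE>(g, f) : \<bbbE>(Z, X) \<rightarrow> \<bbbE>(Z', X')\<close> for \<open>g : Z' \<rightarrow> Z\<close> and \<open>f : X \<rightarrow> X'\<close>.
  A sequence \<open>X \<rightarrow> Y \<rightarrow> Z\<close> with maps \<open>f\<close>, \<open>g\<close> and end terms given by the context is the
  triple \<open>(f, Y, g)\<close>; \<open>Real C Z X \<delta>\<close> is the class \<open>\<s>(\<delta>)\<close> of such triples.
\<close>

record ('o, 'm, 'e) extri = "('o, 'm) category" +
  Ext :: "'o \<Rightarrow> 'o \<Rightarrow> 'e monoid"
  Extmap :: "'m \<Rightarrow> 'm \<Rightarrow> 'e \<Rightarrow> 'e"
  Real :: "'o \<Rightarrow> 'o \<Rightarrow> 'e \<Rightarrow> ('m \<times> 'o \<times> 'm) set"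

abbreviation extension :: "('o, 'm, 'e, 'x) extri_scheme \<Rightarrow> 'e \<Rightarrow> 'o \<Rightarrow> 'o \<Rightarrow> bool"
  where "extension C \<delta> Z X \<equiv> Z \<in> Obj C \<and> X \<in> Obj C \<and> \<delta> \<in> carrier (Ext C Z X)"

locale additive_bifunctor = additive_category C
  for C :: "('o, 'm, 'e, 'x) extri_scheme" (structure) +
  assumes ext_group: "\<lbrakk>Z \<in> Obj C; X \<in> Obj C\<rbrakk> \<Longrightarrow> comm_group (Ext C Z X)"
    and ext_hom: "\<lbrakk>arrow C g Z' Z; arrow C f X X'\<rbrakk>
      \<Longrightarrow> Extmap C g f \<in> hom (Ext C Z X) (Ext C Z' X')"
    and ext_ident: "extension C \<delta> Z X \<Longrightarrow> Extmap C (ident C Z) (ident C X) \<delta> = \<delta>"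
    and ext_comp: "\<lbrakk>arrow C g Z' Z; arrow C g' Z'' Z'; arrow C f X X'; arrow C f' X' X'';
        extension C \<delta> Z X\<rbrakk>
      \<Longrightarrow> Extmap C (g \<cdot> g') (f' \<cdot> f) \<delta> = Extmap C g' f' (Extmap C g f \<delta>)"
    and ext_add_contra: "\<lbrakk>arrow C g Z' Z; arrow C g' Z' Z; arrow C f X X'; extension C \<delta> Z X\<rbrakk>
      \<Longrightarrow> Extmap C (add_mor C Z' Z g g') f \<delta>
            = Extmap C g f \<delta> \<otimes>\<^bsub>Ext C Z' X'\<^esub> Extmap C g' f \<delta>"
    and ext_add_co: "\<lbrakk>arrow C g Z' Z; arrow C f X X'; arrow C f' X X'; extension C \<delta> Z X\<rbrakk>
      \<Longrightarrow> Extmap C g (add_mor C X X' f f') \<delta>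
            = Extmap C g f \<delta> \<otimes>\<^bsub>Ext C Z' X'\<^esub> Extmap C g f' \<delta>"

text \<open>
  \<open>push C Z f \<delta>\<close> is \<open>f\<^sub>* \<delta>\<close> for \<open>\<delta> \<in> \<bbbE>(Z, X)\<close> and \<open>f : X \<rightarrow> X'\<close>;
  \<open>pull C X g \<delta>\<close> is \<open>g\<^sup>* \<delta>\<close> for \<open>\<delta> \<in> \<bbbE>(Z, X)\<close> and \<open>g : Z' \<rightarrow> Z\<close>.
\<close>

definition push :: "('o, 'm, 'e, 'x) extri_scheme \<Rightarrow> 'o \<Rightarrow> 'm \<Rightarrow> 'e \<Rightarrow> 'e"
  where "push C Z f \<delta> = Extmap C (ident C Z) f \<delta>"

definition pull :: "('o, 'm, 'e, 'x) extri_scheme \<Rightarrow> 'o \<Rightarrow> 'm \<Rightarrow> 'e \<Rightarrow> 'e"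
  where "pull C X g \<delta> = Extmap C g (ident C X) \<delta>"

definition sequences :: "('o, 'm, 'x) category_scheme \<Rightarrow> 'o \<Rightarrow> 'o \<Rightarrow> ('m \<times> 'o \<times> 'm) set"
  where "sequences C X Z = {(f, Y, g). arrow C f X Y \<and> arrow C g Y Z}"

definition seq_equiv :: "('o, 'm, 'x) category_scheme \<Rightarrow> 'o \<Rightarrow> 'o \<Rightarrow> ('m \<times> 'o \<times> 'm) rel"
  where "seq_equiv C X Z = {((f, Y, g), (f', Y', g')).
    (f, Y, g) \<in> sequences C X Z \<and> (f', Y', g') \<in> sequences C X Z \<and>
    (\<exists>b. isomorphism C Y Y' b \<and> b \<cdot>\<^bsub>C\<^esub> f = f' \<and> g' \<cdot>\<^bsub>C\<^esub> b = g)}"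

type_synonym ('o, 'm, 'e) triangle = "'o \<times> 'm \<times> 'o \<times> 'm \<times> 'o \<times> 'e"

fun etriangle :: "('o, 'm, 'e, 'x) extri_scheme \<Rightarrow> ('o, 'm, 'e) triangle \<Rightarrow> bool"
  where "etriangle C (X, f, Y, g, Z, \<delta>) \<longleftrightarrow>
    extension C \<delta> Z X \<and> arrow C f X Y \<and> arrow C g Y Z \<and>
    Real C Z X \<delta> = seq_equiv C X Z `` {(f, Y, g)}"

definition inflation :: "('o, 'm, 'e, 'x) extri_scheme \<Rightarrow> 'o \<Rightarrow> 'o \<Rightarrow> 'm \<Rightarrow> bool"
  where "inflation C X Y f \<longleftrightarrow> (\<exists>g Z \<delta>. etriangle C (X, f, Y, g, Z, \<delta>))"

definition deflation :: "('o, 'm, 'e, 'x) extri_scheme \<Rightarrow> 'o \<Rightarrow> 'o \<Rightarrow> 'm \<Rightarrow> bool"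
  where "deflation C Y Z g \<longleftrightarrow> (\<exists>X f \<delta>. etriangle C (X, f, Y, g, Z, \<delta>))"

fun etriangle_mor :: "('o, 'm, 'e, 'x) extri_scheme
    \<Rightarrow> ('o, 'm, 'e) triangle \<Rightarrow> ('o, 'm, 'e) triangle \<Rightarrow> 'm \<times> 'm \<times> 'm \<Rightarrow> bool"
  where "etriangle_mor C (X, f, Y, g, Z, \<delta>) (X', f', Y', g', Z', \<delta>') (\<alpha>, \<beta>, \<gamma>) \<longleftrightarrow>
    arrow C \<alpha> X X' \<and> arrow C \<beta> Y Y' \<and> arrow C \<gamma> Z Z' \<and>
    \<beta> \<cdot>\<^bsub>C\<^esub> f = f' \<cdot>\<^bsub>C\<^esub> \<alpha> \<and> g' \<cdot>\<^bsub>C\<^esub> \<beta> = \<gamma> \<cdot>\<^bsub>C\<^esub> g \<and> push C Z \<alpha> \<delta> = pull C X' \<gamma> \<delta>'"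

text \<open>
  In \<open>real_sum\<close>, \<open>S\<^sub>X\<close>, \<open>S\<^sub>Y\<close>, \<open>S\<^sub>Z\<close> are the direct sums of the left, middle and right terms.
  The extension \<open>\<delta> \<oplus> \<delta>'\<close> is the element of \<open>\<bbbE>(S\<^sub>Z, S\<^sub>X)\<close> corresponding to
  \<open>(\<delta>, 0, 0, \<delta>')\<close> under the decomposition
  \<open>\<bbbE>(S\<^sub>Z, S\<^sub>X) \<cong> \<bbbE>(Z, X) \<oplus> \<bbbE>(Z, X') \<oplus> \<bbbE>(Z', X) \<oplus> \<bbbE>(Z', X')\<close>, that is
  \<open>\<bbbE>(q\<^sub>1, j\<^sub>1) \<delta> + \<bbbE>(q\<^sub>2, j\<^sub>2) \<delta>'\<close>.
\<close>

locale additive_realization = additive_bifunctor +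
  assumes real_class: "extension C \<delta> Z X
      \<Longrightarrow> Real C Z X \<delta> \<in> sequences C X Z // seq_equiv C X Z"
    and real_mor: "\<lbrakk>etriangle C (X, f, Y, g, Z, \<delta>); etriangle C (X', f', Y', g', Z', \<delta>');
        arrow C \<alpha> X X'; arrow C \<gamma> Z Z'; push C Z \<alpha> \<delta> = pull C X' \<gamma> \<delta>'\<rbrakk>
      \<Longrightarrow> \<exists>\<beta>. arrow C \<beta> Y Y' \<and> \<beta> \<cdot> f = f' \<cdot> \<alpha> \<and> g' \<cdot> \<beta> = \<gamma> \<cdot> g"
    and real_zero: "biproduct C X Z S j\<^sub>1 j\<^sub>2 q\<^sub>1 q\<^sub>2
      \<Longrightarrow> etriangle C (X, j\<^sub>1, S, q\<^sub>2, Z, one (Ext C Z X))"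
    and real_sum: "\<lbrakk>etriangle C (X, f, Y, g, Z, \<delta>); etriangle C (X', f', Y', g', Z', \<delta>');
        biproduct C X X' S\<^sub>X jX\<^sub>1 jX\<^sub>2 qX\<^sub>1 qX\<^sub>2;
        biproduct C Y Y' S\<^sub>Y jY\<^sub>1 jY\<^sub>2 qY\<^sub>1 qY\<^sub>2;
        biproduct C Z Z' S\<^sub>Z jZ\<^sub>1 jZ\<^sub>2 qZ\<^sub>1 qZ\<^sub>2\<rbrakk>
      \<Longrightarrow> etriangle C
            (S\<^sub>X, add_mor C S\<^sub>X S\<^sub>Y (jY\<^sub>1 \<cdot> f \<cdot> qX\<^sub>1) (jY\<^sub>2 \<cdot> f' \<cdot> qX\<^sub>2),
             S\<^sub>Y, add_mor C S\<^sub>Y S\<^sub>Z (jZ\<^sub>1 \<cdot> g \<cdot> qY\<^sub>1) (jZ\<^sub>2 \<cdot> g' \<cdot> qY\<^sub>2),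
             S\<^sub>Z, Extmap C qZ\<^sub>1 jX\<^sub>1 \<delta> \<otimes>\<^bsub>Ext C S\<^sub>Z S\<^sub>X\<^esub> Extmap C qZ\<^sub>2 jX\<^sub>2 \<delta>')"

locale extriangulated_category = additive_realization +
  assumes ET3: "\<lbrakk>etriangle C (X, f, Y, g, Z, \<delta>); etriangle C (X', f', Y', g', Z', \<delta>');
        arrow C \<alpha> X X'; arrow C \<beta> Y Y'; \<beta> \<cdot> f = f' \<cdot> \<alpha>\<rbrakk>
      \<Longrightarrow> \<exists>\<gamma>. etriangle_mor C (X, f, Y, g, Z, \<delta>) (X', f', Y', g', Z', \<delta>') (\<alpha>, \<beta>, \<gamma>)"
    and ET3_op: "\<lbrakk>etriangle C (X, f, Y, g, Z, \<delta>); etriangle C (X', f', Y', g', Z', \<delta>');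
        arrow C \<beta> Y Y'; arrow C \<gamma> Z Z'; \<gamma> \<cdot> g = g' \<cdot> \<beta>\<rbrakk>
      \<Longrightarrow> \<exists>\<alpha>. etriangle_mor C (X, f, Y, g, Z, \<delta>) (X', f', Y', g', Z', \<delta>') (\<alpha>, \<beta>, \<gamma>)"
    and ET4: "\<lbrakk>etriangle C (A, f, B, g, D, \<delta>); etriangle C (B, u, M, v, E, \<epsilon>)\<rbrakk>
      \<Longrightarrow> \<exists>m h F \<theta> w q \<eta>.
            etriangle C (A, m, M, h, F, \<theta>) \<and> etriangle C (D, w, F, q, E, \<eta>) \<and>
            m = u \<cdot> f \<and> w \<cdot> g = h \<cdot> u \<and> v = q \<cdot> h \<and>
            pull C A w \<theta> = \<delta> \<and> push C E g \<epsilon> = \<eta> \<and> push C F f \<theta> = pull C B q \<epsilon>"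
    and ET4_op: "\<lbrakk>etriangle C (A, m, M, h, F, \<theta>); etriangle C (D, w, F, q, E, \<eta>)\<rbrakk>
      \<Longrightarrow> \<exists>f B g \<delta> u v \<epsilon>.
            etriangle C (A, f, B, g, D, \<delta>) \<and> etriangle C (B, u, M, v, E, \<epsilon>) \<and>
            m = u \<cdot> f \<and> w \<cdot> g = h \<cdot> u \<and> v = q \<cdot> h \<and>
            pull C A w \<theta> = \<delta> \<and> push C E g \<epsilon> = \<eta> \<and> push C F f \<theta> = pull C B q \<epsilon>"

text \<open>
  Arguments: the three rows \<open>A\<close>, \<open>B\<close>, \<open>K\<close> (top to bottom), then for each column the two
  morphisms and the extension; the objects of the columns are those of the rows.
\<close>

fun three_by_three :: "('o, 'm, 'e, 'x) extri_scheme
    \<Rightarrow> ('o, 'm, 'e) triangle \<Rightarrow> ('o, 'm, 'e) triangle \<Rightarrow> ('o, 'm, 'e) triangle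
    \<Rightarrow> 'm \<times> 'm \<times> 'e \<Rightarrow> 'm \<times> 'm \<times> 'e \<Rightarrow> 'm \<times> 'm \<times> 'e \<Rightarrow> bool"
  where "three_by_three C (A\<^sub>1, f\<^sub>A, A\<^sub>2, g\<^sub>A, A\<^sub>3, \<delta>\<^sub>A) (B\<^sub>1, f\<^sub>B, B\<^sub>2, g\<^sub>B, B\<^sub>3, \<delta>\<^sub>B) (K\<^sub>1, f\<^sub>K, K\<^sub>2, g\<^sub>K, K\<^sub>3, \<delta>\<^sub>K)
      (i\<^sub>1, p\<^sub>1, \<epsilon>\<^sub>1) (i\<^sub>2, p\<^sub>2, \<epsilon>\<^sub>2) (i\<^sub>3, p\<^sub>3, \<epsilon>\<^sub>3) \<longleftrightarrow>
    (let A = (A\<^sub>1, f\<^sub>A, A\<^sub>2, g\<^sub>A, A\<^sub>3, \<delta>\<^sub>A); B = (B\<^sub>1, f\<^sub>B, B\<^sub>2, g\<^sub>B, B\<^sub>3, \<delta>\<^sub>B);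
         K = (K\<^sub>1, f\<^sub>K, K\<^sub>2, g\<^sub>K, K\<^sub>3, \<delta>\<^sub>K);
         col\<^sub>1 = (A\<^sub>1, i\<^sub>1, B\<^sub>1, p\<^sub>1, K\<^sub>1, \<epsilon>\<^sub>1); col\<^sub>2 = (A\<^sub>2, i\<^sub>2, B\<^sub>2, p\<^sub>2, K\<^sub>2, \<epsilon>\<^sub>2);
         col\<^sub>3 = (A\<^sub>3, i\<^sub>3, B\<^sub>3, p\<^sub>3, K\<^sub>3, \<epsilon>\<^sub>3)
     in etriangle C A \<and> etriangle C B \<and> etriangle C K \<and>
        etriangle C col\<^sub>1 \<and> etriangle C col\<^sub>2 \<and> etriangle C col\<^sub>3 \<and>
        etriangle_mor C A B (i\<^sub>1, i\<^sub>2, i\<^sub>3) \<and> etriangle_mor C B K (p\<^sub>1, p\<^sub>2, p\<^sub>3) \<and>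
        etriangle_mor C col\<^sub>1 col\<^sub>2 (f\<^sub>A, f\<^sub>B, f\<^sub>K) \<and> etriangle_mor C col\<^sub>2 col\<^sub>3 (g\<^sub>A, g\<^sub>B, g\<^sub>K))"

text \<open>
  For a direct sum \<open>S\<close> of \<open>Y\<close> and \<open>Z\<close> with injections \<open>j\<^sub>1\<close>, \<open>j\<^sub>2\<close> and projections
  \<open>q\<^sub>1\<close>, \<open>q\<^sub>2\<close>: the column morphism \<open>X \<rightarrow> S\<close> with components \<open>a : X \<rightarrow> Y\<close>, \<open>b : X \<rightarrow> Z\<close>,
  and the row morphism \<open>S \<rightarrow> X\<close> with components \<open>a : Y \<rightarrow> X\<close>, \<open>b : Z \<rightarrow> X\<close>.
\<close>

definition column_mor :: "('o, 'm, 'x) category_scheme \<Rightarrow> 'o \<Rightarrow> 'o \<Rightarrow> 'm \<Rightarrow> 'm \<Rightarrow> 'm \<Rightarrow> 'm \<Rightarrow> 'm"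
  where "column_mor C X S j\<^sub>1 j\<^sub>2 a b = add_mor C X S (j\<^sub>1 \<cdot>\<^bsub>C\<^esub> a) (j\<^sub>2 \<cdot>\<^bsub>C\<^esub> b)"

definition row_mor :: "('o, 'm, 'x) category_scheme \<Rightarrow> 'o \<Rightarrow> 'o \<Rightarrow> 'm \<Rightarrow> 'm \<Rightarrow> 'm \<Rightarrow> 'm \<Rightarrow> 'm"
  where "row_mor C S X q\<^sub>1 q\<^sub>2 a b = add_mor C S X (a \<cdot>\<^bsub>C\<^esub> q\<^sub>1) (b \<cdot>\<^bsub>C\<^esub> q\<^sub>2)"

end

theory Submission
  imports Defs
begin

text \<open>
  A section is \<^emph>\<open>complemented\<close> if it is an injection of a biproduct.  A category is weakly
  idempotent complete exactly when all its sections are complemented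
  (\<open>weakly_idempotent_completeI\<close>, \<open>weakly_idempotent_complete_biproduct\<close>).  In this form the
  condition is self-dual.  Since the opposite of an extriangulated category is extriangulated
  (\<open>opposite_extriangulated\<close>), each criterion on deflations is the corresponding criterion on
  inflations in the opposite category, and only the latter need an argument.

  Let all sections be complemented, and let \<open>(i, 0) : X \<rightarrow> Y \<oplus> Z\<close> be an inflation with cone \<open>W\<close>.  The
  projection to \<open>Z\<close> factors through a retraction \<open>W \<rightarrow> Z\<close>, which therefore is a deflation, with fibre
  \<open>V\<close>, say; (ET4op) for \<open>Y \<oplus> Z \<rightarrow> W \<rightarrow> Z\<close> yields an \<open>\<bbbE>\<close>-triangle \<open>X \<rightarrow> Y \<rightarrow> V\<close> that starts with \<open>i\<close>
  (\<open>inflation_drop_zero\<close>).  If \<open>g f\<close> is an inflation, so is \<open>(g f, f) : X \<rightarrow> Z \<oplus> Y\<close>, and a shear of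
  \<open>Z \<oplus> Y\<close> turns it into \<open>(0, f)\<close>; hence \<open>f\<close> is an inflation (\<open>inflation_left_cancel\<close>).  Closure under
  retracts follows by applying this twice, and it allows in turn to drop the component zero, because
  \<open>i\<close> is a retract of \<open>(i, 0)\<close>.  Conversely, cancellation makes every section \<open>s\<close> an inflation, as \<open>r s = 1\<close>
  is one; its extension is \<open>\<delta> = r\<^sub>* s\<^sub>* \<delta> = 0\<close>, so the \<open>\<bbbE>\<close>-triangle splits and \<open>s\<close> is complemented.

  For the three-by-three lemma (\<open>three_by_three_lemma\<close>), the given square provides morphisms
  \<open>(i\<^sub>2, g\<^sub>A) : A\<^sub>2 \<rightarrow> B\<^sub>2 \<oplus> A\<^sub>3\<close> and \<open>(g\<^sub>B, - i\<^sub>3) : B\<^sub>2 \<oplus> A\<^sub>3 \<rightarrow> B\<^sub>3\<close> with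
  composite zero; the first is an inflation, the second a deflation.  Let
  \<open>Q\<close> be the fibre of the second and \<open>F\<close> the cone of the first.  By cancellation \<open>A\<^sub>2 \<rightarrow> Q\<close> is an
  inflation, and its cone is the missing object \<open>C\<^sub>1\<close>.  Here \<open>Q\<close> is an extension of \<open>A\<^sub>3\<close> by \<open>B\<^sub>1\<close>,
  and \<open>F\<close> is an extension of \<open>C\<^sub>2\<close> by \<open>A\<^sub>3\<close> and also, by (ET4), of \<open>B\<^sub>3\<close> by \<open>C\<^sub>1\<close>.  The factorization
  \<open>A\<^sub>2 \<rightarrow> Q \<rightarrow> A\<^sub>3\<close> of the deflation \<open>g\<^sub>A\<close> produces the column \<open>A\<^sub>1 \<rightarrow> B\<^sub>1 \<rightarrow> C\<^sub>1\<close> (\<open>third_fibre\<close>), and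
  the factorization \<open>A\<^sub>3 \<rightarrow> F \<rightarrow> B\<^sub>3\<close> of the inflation \<open>i\<^sub>3\<close> produces the row \<open>C\<^sub>1 \<rightarrow> C\<^sub>2 \<rightarrow> C\<^sub>3\<close>
  (\<open>third_cofibre\<close>).  Since both are built from the same \<open>Q\<close> and \<open>F\<close>, they fit together; arbitrary
  fill-ins obtained from (ET3) need not.  Conversely, for a section \<open>s : X \<rightarrow> Y\<close> a three-by-three
  diagram built from split \<open>\<bbbE>\<close>-triangles has \<open>s\<close> as the inflation of its first column
  (\<open>section_inflation_if_three_by_three\<close>).
\<close>

section \<open>Arithmetic of hom-groups\<close>

abbreviation neg_mor :: "('o, 'm, 'x) category_scheme \<Rightarrow> 'o \<Rightarrow> 'o \<Rightarrow> 'm \<Rightarrow> 'm"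
  where "neg_mor C X Y f \<equiv> m_inv (Hom C X Y) f"

context preadditive_category
begin

lemma ident_mor: "X \<in> Obj C \<Longrightarrow> arrow C (ident C X) X X"
  using ident_closed by blast

lemma zero_closed: "\<lbrakk>X \<in> Obj C; Y \<in> Obj C\<rbrakk> \<Longrightarrow> arrow C (zero_mor C X Y) X Y"
  using hom_group[of X Y] by (simp add: comm_group_def group_def monoid.one_closed)

lemma add_closed: "\<lbrakk>arrow C f X Y; arrow C g X Y\<rbrakk> \<Longrightarrow> arrow C (add_mor C X Y f g) X Y"
  using hom_group[of X Y] by (simp add: comm_group_def group_def monoid.m_closed)

lemma neg_closed: "arrow C f X Y \<Longrightarrow> arrow C (neg_mor C X Y f) X Y"
  using hom_group[of X Y] by (simp add: comm_group_def group.inv_closed)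

lemma add_assoc_mor:
  "\<lbrakk>arrow C f X Y; arrow C g X Y; arrow C h X Y\<rbrakk> \<Longrightarrow>
    add_mor C X Y (add_mor C X Y f g) h = add_mor C X Y f (add_mor C X Y g h)"
  using hom_group[of X Y] by (simp add: comm_group_def group_def monoid.m_assoc)

lemma add_comm_mor:
  "\<lbrakk>arrow C f X Y; arrow C g X Y\<rbrakk> \<Longrightarrow> add_mor C X Y f g = add_mor C X Y g f"
  using hom_group[of X Y] by (simp add: comm_group_def comm_monoid.m_comm)

lemma add_zero:
  assumes "arrow C f X Y"
  shows "add_mor C X Y f (zero_mor C X Y) = f" "add_mor C X Y (zero_mor C X Y) f = f"
  using hom_group[of X Y] assms by (simp_all add: comm_group_def group_def monoid.r_one monoid.l_one)

lemma add_neg: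
  assumes "arrow C f X Y"
  shows "add_mor C X Y f (neg_mor C X Y f) = zero_mor C X Y"
    "add_mor C X Y (neg_mor C X Y f) f = zero_mor C X Y"
  using hom_group[of X Y] assms by (simp_all add: comm_group_def group.r_inv group.l_inv)

lemma neg_unique:
  assumes "arrow C f X Y" "arrow C g X Y" "add_mor C X Y f g = zero_mor C X Y"
  shows "g = neg_mor C X Y f"
proof -
  interpret comm_group "Hom C X Y" using hom_group assms by blast
  show ?thesis using assms by (metis inv_equality m_comm)
qed

lemma neg_neg: "arrow C f X Y \<Longrightarrow> neg_mor C X Y (neg_mor C X Y f) = f"
  using hom_group[of X Y] by (simp add: comm_group_def group.inv_inv)

lemma neg_zero: "\<lbrakk>X \<in> Obj C; Y \<in> Obj C\<rbrakk> \<Longrightarrow> neg_mor C X Y (zero_mor C X Y) = zero_mor C X Y"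
  using hom_group[of X Y] by (simp add: comm_group_def group.is_monoid monoid.inv_one)

lemma diff_zero_eq:
  assumes "arrow C f X Y" "arrow C g X Y"
    "add_mor C X Y f (neg_mor C X Y g) = zero_mor C X Y"
  shows "f = g"
  using neg_unique[OF neg_closed[OF assms(2)] assms(1)] neg_neg[OF assms(2)] assms(3)
    add_comm_mor[OF assms(1) neg_closed[OF assms(2)]] by simp

lemma comp_zero_right:
  assumes "arrow C g Y Z" "X \<in> Obj C"
  shows "g \<cdot> zero_mor C X Y = zero_mor C X Z"
proof -
  interpret comm_group "Hom C X Z" using hom_group assms by blast
  have z: "arrow C (zero_mor C X Y) X Y" using zero_closed assms by blast
  have "g \<cdot> add_mor C X Y (zero_mor C X Y) (zero_mor C X Y) = g \<cdot> zero_mor C X Y"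
    using add_zero[OF z] by simp
  then show ?thesis using comp_add_right[OF z z assms(1)] comp_closed[OF z assms(1)]
    by (metis l_cancel_one)
qed

lemma comp_zero_left:
  assumes "arrow C f X Y" "Z \<in> Obj C"
  shows "zero_mor C Y Z \<cdot> f = zero_mor C X Z"
proof -
  interpret comm_group "Hom C X Z" using hom_group assms by blast
  have z: "arrow C (zero_mor C Y Z) Y Z" using zero_closed assms by blast
  have "add_mor C Y Z (zero_mor C Y Z) (zero_mor C Y Z) \<cdot> f = zero_mor C Y Z \<cdot> f"
    using add_zero[OF z] by simp
  then show ?thesis using comp_add_left[OF assms(1) z z] comp_closed[OF assms(1) z]
    by (metis l_cancel_one)
qed

lemma comp_neg_right:
  assumes "arrow C f X Y" "arrow C g Y Z"
  shows "g \<cdot> neg_mor C X Y f = neg_mor C X Z (g \<cdot> f)"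
proof (rule neg_unique[OF comp_closed[OF assms] comp_closed[OF neg_closed[OF assms(1)] assms(2)]])
  show "add_mor C X Z (g \<cdot> f) (g \<cdot> neg_mor C X Y f) = zero_mor C X Z"
    using comp_add_right[OF assms(1) neg_closed[OF assms(1)] assms(2)] add_neg[OF assms(1)]
      comp_zero_right[OF assms(2)] assms(1) by simp
qed

lemma comp_neg_left:
  assumes "arrow C f X Y" "arrow C g Y Z"
  shows "neg_mor C Y Z g \<cdot> f = neg_mor C X Z (g \<cdot> f)"
proof (rule neg_unique[OF comp_closed[OF assms] comp_closed[OF assms(1) neg_closed[OF assms(2)]]])
  show "add_mor C X Z (g \<cdot> f) (neg_mor C Y Z g \<cdot> f) = zero_mor C X Z"
    using comp_add_left[OF assms(1,2) neg_closed[OF assms(2)]] add_neg[OF assms(2)]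
      comp_zero_left[OF assms(1)] assms(2) by simp
qed

lemma isomorphismI:
  "\<lbrakk>arrow C f X Y; arrow C g Y X; g \<cdot> f = ident C X; f \<cdot> g = ident C Y\<rbrakk> \<Longrightarrow> isomorphism C X Y f"
  by (auto simp: isomorphism_def)

text \<open>
  The inverse of \<open>1 + n\<close> with \<open>n\<^sup>2 = 0\<close> is \<open>1 - n\<close>.
\<close>

lemma unipotent_inverse:
  assumes u: "arrow C u X X"
    and n: "n = add_mor C X X u (neg_mor C X X (ident C X))" and nn: "n \<cdot> n = zero_mor C X X"
  shows "\<exists>v. arrow C v X X \<and> v \<cdot> u = ident C X \<and> u \<cdot> v = ident C X"
proof -
  have X: "X \<in> Obj C" and i: "arrow C (ident C X) X X" using u ident_mor by auto
  interpret comm_group "Hom C X X" using hom_group X by blast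
  have n1: "arrow C n X X" unfolding n by (intro add_closed neg_closed u i)
  have un: "u = add_mor C X X (ident C X) n"
    unfolding n using u i
      m_comm[of "ident C X" "u \<otimes>\<^bsub>Hom C X X\<^esub> inv\<^bsub>Hom C X X\<^esub> ident C X"] by (simp add: m_assoc)
  define v where "v = add_mor C X X (ident C X) (neg_mor C X X n)"
  have nn1: "arrow C (neg_mor C X X n) X X" using neg_closed[OF n1] .
  have v: "arrow C v X X" unfolding v_def by (intro add_closed neg_closed n1 i)
  have nv: "n \<cdot> v = n"
    unfolding v_def using comp_add_right[OF i nn1 n1] comp_ident_right[OF n1]
      comp_neg_right[OF n1 n1] nn add_zero[OF n1] by simp
  have vn: "v \<cdot> n = n"
    unfolding v_def using comp_add_left[OF n1 i nn1] comp_ident_left[OF n1]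
      comp_neg_left[OF n1 n1] nn add_zero[OF n1] by simp
  have s: "add_mor C X X v n = ident C X"
    unfolding v_def using n1 i nn1 by (simp add: m_assoc)
  have "v \<cdot> u = ident C X"
    unfolding un using comp_add_right[OF i n1 v] comp_ident_right[OF v] vn s by simp
  moreover have "u \<cdot> v = ident C X"
    unfolding un using comp_add_left[OF v i n1] comp_ident_left[OF v] nv s by simp
  ultimately show ?thesis using v by blast
qed

text \<open>
  Two morphisms in opposite directions whose composites are unipotent are isomorphisms, though not
  necessarily inverse to each other: each composite is invertible, so \<open>f\<close> has a left and a right
  inverse.
\<close>

lemma iso_of_unipotent:
  assumes f: "arrow C f X Y" and g: "arrow C g Y X"
    and n: "n = add_mor C X X (g \<cdot> f) (neg_mor C X X (ident C X))" "n \<cdot> n = zero_mor C X X"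
    and m: "m = add_mor C Y Y (f \<cdot> g) (neg_mor C Y Y (ident C Y))" "m \<cdot> m = zero_mor C Y Y"
  shows "isomorphism C X Y f"
proof -
  obtain v where v: "arrow C v X X" "v \<cdot> (g \<cdot> f) = ident C X"
    using unipotent_inverse[OF comp_closed[OF f g] n] by blast
  obtain w where w: "arrow C w Y Y" "(f \<cdot> g) \<cdot> w = ident C Y"
    using unipotent_inverse[OF comp_closed[OF g f] m] by blast
  have l: "arrow C (v \<cdot> g) Y X" and r: "arrow C (g \<cdot> w) Y X"
    using comp_closed v w g by blast+
  have lf: "(v \<cdot> g) \<cdot> f = ident C X" using comp_assoc[OF f g v(1)] v by simp
  have fr: "f \<cdot> (g \<cdot> w) = ident C Y" using comp_assoc[OF w(1) g f] w by simp
  have "v \<cdot> g = g \<cdot> w"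
    using comp_assoc[OF r f l] lf fr comp_ident_left[OF r] comp_ident_right[OF l] by simp
  then show ?thesis using isomorphismI[OF f l lf] fr by simp
qed

lemma isomorphism_inverse:
  assumes "isomorphism C X Y f"
  obtains g where "isomorphism C Y X g" "arrow C f X Y" "arrow C g Y X"
    "g \<cdot> f = ident C X" "f \<cdot> g = ident C Y"
  using assms isomorphismI unfolding isomorphism_def by blast

lemma isomorphism_comp:
  assumes "isomorphism C X Y f" "isomorphism C Y Z g"
  shows "isomorphism C X Z (g \<cdot> f)"
proof -
  from assms(1) obtain f' where f: "arrow C f X Y" "arrow C f' Y X"
    "f' \<cdot> f = ident C X" "f \<cdot> f' = ident C Y" by (rule isomorphism_inverse)
  from assms(2) obtain g' where g: "arrow C g Y Z" "arrow C g' Z Y"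
    "g' \<cdot> g = ident C Y" "g \<cdot> g' = ident C Z" by (rule isomorphism_inverse)
  have gf: "arrow C (g \<cdot> f) X Z" and fg: "arrow C (f' \<cdot> g') Z X" using comp_closed f g by blast+
  have "(f' \<cdot> g') \<cdot> (g \<cdot> f) = f' \<cdot> ((g' \<cdot> g) \<cdot> f)"
    using comp_assoc[OF gf g(2) f(2)] comp_assoc[OF f(1) g(1) g(2)] by simp
  moreover have "(g \<cdot> f) \<cdot> (f' \<cdot> g') = g \<cdot> ((f \<cdot> f') \<cdot> g')"
    using comp_assoc[OF fg f(1) g(1)] comp_assoc[OF g(2) f(2) f(1)] by simp
  ultimately show ?thesis
    using isomorphismI[OF gf fg] f g comp_ident_left[OF f(1)] comp_ident_left[OF g(2)] by simp
qed

end

section \<open>Biproducts\<close>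

context preadditive_category
begin

lemma biproductD:
  assumes "biproduct C X Y S j\<^sub>1 j\<^sub>2 q\<^sub>1 q\<^sub>2"
  shows "arrow C j\<^sub>1 X S" "arrow C j\<^sub>2 Y S" "arrow C q\<^sub>1 S X" "arrow C q\<^sub>2 S Y"
    "q\<^sub>1 \<cdot> j\<^sub>1 = ident C X" "q\<^sub>2 \<cdot> j\<^sub>2 = ident C Y"
    "q\<^sub>2 \<cdot> j\<^sub>1 = zero_mor C X Y" "q\<^sub>1 \<cdot> j\<^sub>2 = zero_mor C Y X"
    "add_mor C S S (j\<^sub>1 \<cdot> q\<^sub>1) (j\<^sub>2 \<cdot> q\<^sub>2) = ident C S"
  using assms unfolding biproduct_def by auto

lemma biproduct_swap:
  assumes "biproduct C X Y S j\<^sub>1 j\<^sub>2 q\<^sub>1 q\<^sub>2"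
  shows "biproduct C Y X S j\<^sub>2 j\<^sub>1 q\<^sub>2 q\<^sub>1"
proof -
  note b = biproductD[OF assms]
  show ?thesis unfolding biproduct_def
    using b add_comm_mor[OF comp_closed[OF b(3,1)] comp_closed[OF b(4,2)]] by simp
qed

lemma biproduct_neg:
  assumes b: "biproduct C X Y S j\<^sub>1 j\<^sub>2 q\<^sub>1 q\<^sub>2"
  shows "biproduct C X Y S j\<^sub>1 (neg_mor C Y S j\<^sub>2) q\<^sub>1 (neg_mor C S Y q\<^sub>2)"
proof -
  note b = biproductD[OF b]
  note nj = neg_closed[OF b(2)] and nq = neg_closed[OF b(4)]
  have X: "X \<in> Obj C" and Y: "Y \<in> Obj C" using b by auto
  show ?thesis unfolding biproduct_def
    using b nj nq comp_neg_left[OF nj b(4)] comp_neg_right[OF b(2) b(4)]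
      neg_neg[OF ident_mor[OF Y]] comp_neg_left[OF b(1) b(4)] comp_neg_right[OF b(2) b(3)]
      comp_neg_left[OF nq b(2)] comp_neg_right[OF b(4) b(2)]
      neg_neg[OF comp_closed[OF b(4) b(2)]] neg_zero[OF X Y] neg_zero[OF Y X] by simp
qed

text \<open>
  A matrix calculation with a sum decomposition can be carried out by changing the decomposition
  instead of applying an automorphism of the sum: this is the effect of the automorphism
  with matrix rows \<open>(1, t)\<close> and \<open>(0, 1)\<close>.
\<close>

lemma biproduct_shear:
  assumes b: "biproduct C X Y S j\<^sub>1 j\<^sub>2 q\<^sub>1 q\<^sub>2" and t: "arrow C t Y X"
  shows "biproduct C X Y S j\<^sub>1 (add_mor C Y S (j\<^sub>1 \<cdot> t) j\<^sub>2)
    (add_mor C S X q\<^sub>1 (neg_mor C S X (t \<cdot> q\<^sub>2))) q\<^sub>2"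
proof -
  note b = biproductD[OF b]
  have X: "X \<in> Obj C" and Y: "Y \<in> Obj C" using b by auto
  note jt = comp_closed[OF t b(1)] and tq = comp_closed[OF b(4) t]
  note ntq = neg_closed[OF tq]
  let ?J = "add_mor C Y S (j\<^sub>1 \<cdot> t) j\<^sub>2" and ?Q = "add_mor C S X q\<^sub>1 (neg_mor C S X (t \<cdot> q\<^sub>2))"
  note J = add_closed[OF jt b(2)] and Q = add_closed[OF b(3) ntq]
  have q1J: "q\<^sub>1 \<cdot> ?J = t"
    using comp_add_right[OF jt b(2) b(3)] comp_assoc[OF t b(1) b(3)] b(5,8) comp_ident_left[OF t]
      add_zero[OF t] by simp
  have q2J: "q\<^sub>2 \<cdot> ?J = ident C Y"
    using comp_add_right[OF jt b(2) b(4)] comp_assoc[OF t b(1) b(4)] b(6,7) comp_zero_left[OF t Y]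
      add_zero[OF ident_mor[OF Y]] by simp
  have Qj1: "?Q \<cdot> j\<^sub>1 = ident C X"
    using comp_add_left[OF b(1) b(3) ntq] comp_neg_left[OF b(1) tq] comp_assoc[OF b(1) b(4) t]
      b(5,7) comp_zero_right[OF t X] neg_zero[OF X X] add_zero[OF ident_mor[OF X]] by simp
  have QJ: "?Q \<cdot> ?J = zero_mor C Y X"
    using comp_add_left[OF J b(3) ntq] comp_neg_left[OF J tq] comp_assoc[OF J b(4) t]
      q1J q2J comp_ident_right[OF t] add_neg[OF t] by simp
  interpret comm_group "Hom C S S" using hom_group b by blast
  note e1 = comp_closed[OF b(3) b(1)] and e2 = comp_closed[OF b(4) b(2)]
  note e3 = comp_closed[OF tq b(1)]
  have "add_mor C S S (j\<^sub>1 \<cdot> ?Q) (?J \<cdot> q\<^sub>2) =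
      add_mor C S S (add_mor C S S (j\<^sub>1 \<cdot> q\<^sub>1) (neg_mor C S S (j\<^sub>1 \<cdot> (t \<cdot> q\<^sub>2))))
        (add_mor C S S (j\<^sub>1 \<cdot> (t \<cdot> q\<^sub>2)) (j\<^sub>2 \<cdot> q\<^sub>2))"
    using comp_add_right[OF b(3) ntq b(1)] comp_neg_right[OF tq b(1)]
      comp_add_left[OF b(4) jt b(2)] comp_assoc[OF b(4) t b(1)] by simp
  also have "\<dots> = add_mor C S S (j\<^sub>1 \<cdot> q\<^sub>1) (add_mor C S S (add_mor C S S
        (neg_mor C S S (j\<^sub>1 \<cdot> (t \<cdot> q\<^sub>2))) (j\<^sub>1 \<cdot> (t \<cdot> q\<^sub>2))) (j\<^sub>2 \<cdot> q\<^sub>2))"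
    using e1 e2 e3 by (metis m_assoc m_closed inv_closed)
  also have "\<dots> = add_mor C S S (j\<^sub>1 \<cdot> q\<^sub>1) (j\<^sub>2 \<cdot> q\<^sub>2)" using e2 e3 by simp
  finally have "add_mor C S S (j\<^sub>1 \<cdot> ?Q) (?J \<cdot> q\<^sub>2) = ident C S" using b(9) by simp
  then show ?thesis unfolding biproduct_def using b J Q q2J Qj1 QJ by simp
qed

lemma column_comp:
  assumes b: "biproduct C X Y S j\<^sub>1 j\<^sub>2 q\<^sub>1 q\<^sub>2" and f: "arrow C f T X" "arrow C g T Y"
  shows "arrow C (column_mor C T S j\<^sub>1 j\<^sub>2 f g) T S"
    "q\<^sub>1 \<cdot> column_mor C T S j\<^sub>1 j\<^sub>2 f g = f" "q\<^sub>2 \<cdot> column_mor C T S j\<^sub>1 j\<^sub>2 f g = g"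
proof -
  note b = biproductD[OF b]
  have X: "X \<in> Obj C" and Y: "Y \<in> Obj C" using b by auto
  note c1 = comp_closed[OF f(1) b(1)] and c2 = comp_closed[OF f(2) b(2)]
  show "arrow C (column_mor C T S j\<^sub>1 j\<^sub>2 f g) T S"
    unfolding column_mor_def by (rule add_closed[OF c1 c2])
  show "q\<^sub>1 \<cdot> column_mor C T S j\<^sub>1 j\<^sub>2 f g = f"
    unfolding column_mor_def
    using comp_add_right[OF c1 c2 b(3)] comp_assoc[OF f(1) b(1) b(3)] comp_assoc[OF f(2) b(2) b(3)]
      b(5,8) comp_ident_left[OF f(1)] comp_zero_left[OF f(2) X] add_zero[OF f(1)] by simp
  show "q\<^sub>2 \<cdot> column_mor C T S j\<^sub>1 j\<^sub>2 f g = g"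
    unfolding column_mor_def
    using comp_add_right[OF c1 c2 b(4)] comp_assoc[OF f(1) b(1) b(4)] comp_assoc[OF f(2) b(2) b(4)]
      b(6,7) comp_ident_left[OF f(2)] comp_zero_left[OF f(1) Y] add_zero[OF f(2)] by simp
qed

lemma row_comp:
  assumes b: "biproduct C X Y S j\<^sub>1 j\<^sub>2 q\<^sub>1 q\<^sub>2" and f: "arrow C f X T" "arrow C g Y T"
  shows "arrow C (row_mor C S T q\<^sub>1 q\<^sub>2 f g) S T"
    "row_mor C S T q\<^sub>1 q\<^sub>2 f g \<cdot> j\<^sub>1 = f" "row_mor C S T q\<^sub>1 q\<^sub>2 f g \<cdot> j\<^sub>2 = g"
proof -
  note b = biproductD[OF b]
  have X: "X \<in> Obj C" and Y: "Y \<in> Obj C" using b by auto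
  note c1 = comp_closed[OF b(3) f(1)] and c2 = comp_closed[OF b(4) f(2)]
  show "arrow C (row_mor C S T q\<^sub>1 q\<^sub>2 f g) S T"
    unfolding row_mor_def by (rule add_closed[OF c1 c2])
  show "row_mor C S T q\<^sub>1 q\<^sub>2 f g \<cdot> j\<^sub>1 = f"
    unfolding row_mor_def
    using comp_add_left[OF b(1) c1 c2] comp_assoc[OF b(1) b(3) f(1)] comp_assoc[OF b(1) b(4) f(2)]
      b(5,7) comp_ident_right[OF f(1)] comp_zero_right[OF f(2) X] add_zero[OF f(1)] by simp
  show "row_mor C S T q\<^sub>1 q\<^sub>2 f g \<cdot> j\<^sub>2 = g"
    unfolding row_mor_def
    using comp_add_left[OF b(2) c1 c2] comp_assoc[OF b(2) b(3) f(1)] comp_assoc[OF b(2) b(4) f(2)]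
      b(6,8) comp_ident_right[OF f(2)] comp_zero_right[OF f(1) Y] add_zero[OF f(2)] by simp
qed

lemma row_column:
  assumes b: "biproduct C X Y S j\<^sub>1 j\<^sub>2 q\<^sub>1 q\<^sub>2" and f: "arrow C f T X" "arrow C g T Y"
    and h: "arrow C h X W" "arrow C k Y W"
  shows "row_mor C S W q\<^sub>1 q\<^sub>2 h k \<cdot> column_mor C T S j\<^sub>1 j\<^sub>2 f g = add_mor C T W (h \<cdot> f) (k \<cdot> g)"
proof -
  note c = column_comp[OF b f] and b = biproductD[OF b]
  note c1 = comp_closed[OF b(3) h(1)] and c2 = comp_closed[OF b(4) h(2)]
  show ?thesis
    using comp_add_left[OF c(1) c1 c2] comp_assoc[OF c(1) b(3) h(1)] comp_assoc[OF c(1) b(4) h(2)]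
      c(2,3) unfolding row_mor_def by simp
qed

lemma biproduct_decomp:
  assumes b: "biproduct C X Y S j\<^sub>1 j\<^sub>2 q\<^sub>1 q\<^sub>2" and f: "arrow C f T S"
  shows "f = column_mor C T S j\<^sub>1 j\<^sub>2 (q\<^sub>1 \<cdot> f) (q\<^sub>2 \<cdot> f)"
proof -
  note b = biproductD[OF b]
  show ?thesis unfolding column_mor_def
    using comp_add_left[OF f comp_closed[OF b(3) b(1)] comp_closed[OF b(4) b(2)]] b(9)
      comp_ident_left[OF f] comp_assoc[OF f b(3) b(1)] comp_assoc[OF f b(4) b(2)] by simp
qed

lemma biproduct_codecomp:
  assumes b: "biproduct C X Y S j\<^sub>1 j\<^sub>2 q\<^sub>1 q\<^sub>2" and f: "arrow C f S T"
  shows "f = row_mor C S T q\<^sub>1 q\<^sub>2 (f \<cdot> j\<^sub>1) (f \<cdot> j\<^sub>2)"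
proof -
  note b = biproductD[OF b]
  show ?thesis unfolding row_mor_def
    using comp_add_right[OF comp_closed[OF b(3) b(1)] comp_closed[OF b(4) b(2)] f] b(9)
      comp_ident_right[OF f] comp_assoc[OF b(3) b(1) f] comp_assoc[OF b(4) b(2) f] by simp
qed

lemma biproduct_coeqI:
  assumes b: "biproduct C X Y S j\<^sub>1 j\<^sub>2 q\<^sub>1 q\<^sub>2" and f: "arrow C f S T" "arrow C g S T"
    and e: "f \<cdot> j\<^sub>1 = g \<cdot> j\<^sub>1" "f \<cdot> j\<^sub>2 = g \<cdot> j\<^sub>2"
  shows "f = g"
  using biproduct_codecomp[OF b f(1)] biproduct_codecomp[OF b f(2)] e by simp

end

section \<open>Weak idempotent completeness as existence of complements\<close>

context preadditive_category
begin

lemma weakly_idempotent_completeI: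
  assumes "\<And>X Y s r. \<lbrakk>arrow C s X Y; arrow C r Y X; r \<cdot> s = ident C X\<rbrakk>
    \<Longrightarrow> \<exists>V v r' w. biproduct C X V Y s v r' w"
  shows "weakly_idempotent_complete C"
  unfolding weakly_idempotent_complete_def
proof (intro allI impI)
  fix X Y s assume "section_mor C X Y s"
  then obtain V v r w where b: "biproduct C X V Y s v r w"
    using assms unfolding section_mor_def by blast
  note B = biproductD[OF b]
  have V: "V \<in> Obj C" using B(4) by simp
  have "\<exists>!u. arrow C u V T \<and> u \<cdot> w = t" if t: "arrow C t Y T" "t \<cdot> s = zero_mor C X T" for T t
  proof (rule ex1I)
    note tv = comp_closed[OF B(2) t(1)] and T = conjunct1[OF conjunct2[OF t(1)]]
    have "t = add_mor C Y T (zero_mor C X T \<cdot> r) (t \<cdot> v \<cdot> w)"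
      using biproduct_codecomp[OF b t(1)] unfolding row_mor_def t(2) .
    then show "arrow C (t \<cdot> v) V T \<and> t \<cdot> v \<cdot> w = t"
      using tv comp_zero_left[OF B(3) T] add_zero(2)[OF comp_closed[OF B(4) tv]] by simp
    fix u assume u: "arrow C u V T \<and> u \<cdot> w = t"
    show "u = t \<cdot> v"
      using comp_assoc[OF B(2,4) conjunct1[OF u]] B(6) comp_ident_right[OF conjunct1[OF u]] u by simp
  qed
  then show "\<exists>K c. cokernel C X Y s K c" using B(1,4,7) unfolding cokernel_def by blast
qed

text \<open>
  The complement of \<open>s\<close> is its cokernel \<open>w\<close>: the idempotent \<open>1 - s r\<close> kills \<open>s\<close>, hence factors as
  \<open>v w\<close>, and \<open>v\<close> is the second injection.
\<close>

lemma weakly_idempotent_complete_biproduct: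
  assumes wic: "weakly_idempotent_complete C"
    and s: "arrow C s X Y" and r: "arrow C r Y X" and rs: "r \<cdot> s = ident C X"
  shows "\<exists>V v w. biproduct C X V Y s v r w"
proof -
  have O: "X \<in> Obj C" "Y \<in> Obj C" using s by simp_all
  note iY = ident_mor[OF O(2)]
  have "section_mor C X Y s" using s r rs unfolding section_mor_def by blast
  then obtain V w where "cokernel C X Y s V w"
    using wic unfolding weakly_idempotent_complete_def by blast
  then have w: "arrow C w Y V" "w \<cdot> s = zero_mor C X V"
    and univ: "\<And>T t. arrow C t Y T \<Longrightarrow> t \<cdot> s = zero_mor C X T \<Longrightarrow> \<exists>!u. arrow C u V T \<and> u \<cdot> w = t"
    unfolding cokernel_def by blast+
  have V: "V \<in> Obj C" using w by simp
  note sr = comp_closed[OF r s]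
  note nsr = neg_closed[OF sr]
  define e where "e = add_mor C Y Y (ident C Y) (neg_mor C Y Y (s \<cdot> r))"
  have e: "arrow C e Y Y" unfolding e_def by (rule add_closed[OF iY nsr])
  have "e \<cdot> s = zero_mor C X Y"
    unfolding e_def
    by (simp only: comp_add_left[OF s iY nsr] comp_neg_left[OF s sr] comp_assoc[OF s r s, symmetric] rs
        comp_ident_left[OF s] comp_ident_right[OF s] add_neg[OF s])
  then obtain v where v: "arrow C v V Y" "v \<cdot> w = e" using univ[OF e] by blast
  have "w \<cdot> e = w"
    unfolding e_def
    by (simp only: comp_add_right[OF iY nsr w(1)] comp_neg_right[OF sr w(1)] comp_assoc[OF r s w(1)]
        w(2) comp_zero_left[OF r V] neg_zero[OF O(2) V] comp_ident_right[OF w(1)] add_zero[OF w(1)])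
  then have "w \<cdot> v \<cdot> w = w" using comp_assoc[OF w(1) v(1) w(1)] v(2) by simp
  then have wv: "w \<cdot> v = ident C V"
    using univ[OF w] comp_closed[OF v(1) w(1)] ident_mor[OF V] comp_ident_left[OF w(1)] by blast
  have re: "r \<cdot> e = zero_mor C Y X"
    unfolding e_def
    by (simp only: comp_add_right[OF iY nsr r] comp_neg_right[OF sr r] comp_assoc[OF r s r] rs
        comp_ident_left[OF r] comp_ident_right[OF r] add_neg[OF r])
  have "r \<cdot> v \<cdot> w = zero_mor C Y X" using comp_assoc[OF w(1) v(1) r] v(2) re by simp
  then have rv: "r \<cdot> v = zero_mor C V X"
    using univ[OF zero_closed[OF O(2,1)] comp_zero_left[OF s O(1)]]
      comp_closed[OF v(1) r] zero_closed[OF V O(1)] comp_zero_left[OF w(1) O(1)] by blast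
  have "add_mor C Y Y (s \<cdot> r) (v \<cdot> w) = ident C Y"
    by (simp only: v(2) e_def add_comm_mor[OF sr add_closed[OF iY nsr]] add_assoc_mor[OF iY nsr sr]
        add_neg[OF sr] add_zero[OF iY])
  then show ?thesis unfolding biproduct_def using s r v(1) w rs rv wv by blast
qed

end

section \<open>Pushing and pulling extensions\<close>

context additive_bifunctor
begin

lemma Extmap_closed:
  "\<lbrakk>arrow C g Z' Z; arrow C f X X'; extension C \<delta> Z X\<rbrakk> \<Longrightarrow> extension C (Extmap C g f \<delta>) Z' X'"
  using ext_hom[of Z' Z g X X' f] by (auto simp: hom_def)

lemma push_closed: "\<lbrakk>arrow C f X X'; extension C \<delta> Z X\<rbrakk> \<Longrightarrow> extension C (push C Z f \<delta>) Z X'"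
  unfolding push_def using Extmap_closed[OF ident_mor] by blast

lemma pull_closed: "\<lbrakk>arrow C g Z' Z; extension C \<delta> Z X\<rbrakk> \<Longrightarrow> extension C (pull C X g \<delta>) Z' X"
  unfolding pull_def using Extmap_closed[OF _ ident_mor] by blast

lemma ext_add_zero:
  assumes "extension C \<delta> Z X"
  shows "\<delta> \<otimes>\<^bsub>Ext C Z X\<^esub> one (Ext C Z X) = \<delta>" "one (Ext C Z X) \<otimes>\<^bsub>Ext C Z X\<^esub> \<delta> = \<delta>"
  using ext_group[of Z X] assms by (simp_all add: comm_group_def group_def monoid.r_one monoid.l_one)

lemma Extmap_one:
  assumes "arrow C g Z' Z" "arrow C f X X'"
  shows "Extmap C g f (one (Ext C Z X)) = one (Ext C Z' X')"
  using hom_one[OF ext_hom[OF assms]] ext_group assms by (simp add: comm_group_def)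

lemma push_one: "\<lbrakk>arrow C f X X'; Z \<in> Obj C\<rbrakk> \<Longrightarrow> push C Z f (one (Ext C Z X)) = one (Ext C Z X')"
  unfolding push_def using Extmap_one[OF ident_mor] by blast

lemma pull_one: "\<lbrakk>arrow C g Z' Z; X \<in> Obj C\<rbrakk> \<Longrightarrow> pull C X g (one (Ext C Z X)) = one (Ext C Z' X)"
  unfolding pull_def using Extmap_one[OF _ ident_mor] by blast

lemma push_ident: "extension C \<delta> Z X \<Longrightarrow> push C Z (ident C X) \<delta> = \<delta>"
  unfolding push_def using ext_ident by blast

lemma pull_ident: "extension C \<delta> Z X \<Longrightarrow> pull C X (ident C Z) \<delta> = \<delta>"
  unfolding pull_def using ext_ident by blast

lemma push_comp:
  assumes "arrow C f X X'" "arrow C f' X' X''" "extension C \<delta> Z X"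
  shows "push C Z (f' \<cdot> f) \<delta> = push C Z f' (push C Z f \<delta>)"
proof -
  have i: "arrow C (ident C Z) Z Z" using ident_mor assms by blast
  show ?thesis unfolding push_def
    using ext_comp[OF i i assms] comp_ident_left[OF i] by simp
qed

lemma pull_comp:
  assumes "arrow C g Z' Z" "arrow C g' Z'' Z'" "extension C \<delta> Z X"
  shows "pull C X (g \<cdot> g') \<delta> = pull C X g' (pull C X g \<delta>)"
proof -
  have i: "arrow C (ident C X) X X" using ident_mor assms by blast
  show ?thesis unfolding pull_def
    using ext_comp[OF assms(1,2) i i assms(3)] comp_ident_left[OF i] by simp
qed

lemma Extmap_eq_push_pull:
  assumes "arrow C g Z' Z" "arrow C f X X'" "extension C \<delta> Z X"
  shows "Extmap C g f \<delta> = push C Z' f (pull C X g \<delta>)"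
    "Extmap C g f \<delta> = pull C X' g (push C Z f \<delta>)"
proof -
  have i: "arrow C (ident C X) X X" "arrow C (ident C X') X' X'"
    "arrow C (ident C Z) Z Z" "arrow C (ident C Z') Z' Z'" using ident_mor assms by blast+
  show "Extmap C g f \<delta> = push C Z' f (pull C X g \<delta>)" unfolding pull_def push_def
    using ext_comp[OF assms(1) i(4) i(1) assms(2,3)] comp_ident_right[OF assms(1)]
      comp_ident_right[OF assms(2)] by simp
  show "Extmap C g f \<delta> = pull C X' g (push C Z f \<delta>)" unfolding pull_def push_def
    using ext_comp[OF i(3) assms(1,2) i(2) assms(3)] comp_ident_left[OF assms(1)]
      comp_ident_left[OF assms(2)] by simp
qed

lemma push_pull:
  "\<lbrakk>arrow C g Z' Z; arrow C f X X'; extension C \<delta> Z X\<rbrakk>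
    \<Longrightarrow> push C Z' f (pull C X g \<delta>) = pull C X' g (push C Z f \<delta>)"
  using Extmap_eq_push_pull by metis

lemma push_add:
  "\<lbrakk>arrow C f X X'; arrow C f' X X'; extension C \<delta> Z X\<rbrakk>
    \<Longrightarrow> push C Z (add_mor C X X' f f') \<delta> = push C Z f \<delta> \<otimes>\<^bsub>Ext C Z X'\<^esub> push C Z f' \<delta>"
  unfolding push_def using ext_add_co[OF ident_mor] by blast

lemma push_zero:
  assumes "extension C \<delta> Z X" "X' \<in> Obj C"
  shows "push C Z (zero_mor C X X') \<delta> = one (Ext C Z X')"
proof -
  interpret comm_group "Ext C Z X'" using ext_group assms by blast
  have z: "arrow C (zero_mor C X X') X X'" using zero_closed assms by blast
  show ?thesis using push_add[OF z z assms(1)] add_zero[OF z] push_closed[OF z assms(1)]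
    by (metis l_cancel_one)
qed

lemma push_neg:
  assumes f: "arrow C f X X'" and d: "extension C \<delta> Z X"
  shows "push C Z (neg_mor C X X' f) \<delta> = m_inv (Ext C Z X') (push C Z f \<delta>)"
proof -
  interpret comm_group "Ext C Z X'" using ext_group f d by blast
  show ?thesis
    using push_add[OF neg_closed[OF f] f d] add_neg[OF f] push_zero[OF d] f
      push_closed[OF f d] push_closed[OF neg_closed[OF f] d] by (metis inv_equality)
qed

end

section \<open>The opposite extriangulated category\<close>

text \<open>
  Besides the arrows, the two arguments of the bifunctor and the two morphisms of every sequence
  change places.
\<close>

definition opposite :: "('o, 'm, 'e, 'x) extri_scheme \<Rightarrow> ('o, 'm, 'e) extri"
  where "opposite C = \<lparr>Obj = Obj C, Hom = \<lambda>X Y. Hom C Y X, comp = \<lambda>g f. f \<cdot>\<^bsub>C\<^esub> g, ident = ident C,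
    Ext = \<lambda>Z X. Ext C X Z, Extmap = \<lambda>g f. Extmap C f g,
    Real = \<lambda>Z X \<delta>. (\<lambda>(f, Y, g). (g, Y, f)) ` Real C X Z \<delta>\<rparr>"

lemma opposite_simps [simp]:
  "Obj (opposite C) = Obj C" "Hom (opposite C) X Y = Hom C Y X"
  "g \<cdot>\<^bsub>opposite C\<^esub> f = f \<cdot>\<^bsub>C\<^esub> g" "ident (opposite C) = ident C"
  "Ext (opposite C) Z X = Ext C X Z" "Extmap (opposite C) g f = Extmap C f g"
  "push (opposite C) Z f \<delta> = pull C Z f \<delta>" "pull (opposite C) X g \<delta> = push C X g \<delta>"
  by (simp_all add: opposite_def push_def pull_def)

lemma Real_opposite: "Real (opposite C) Z X \<delta> = (\<lambda>(f, Y, g). (g, Y, f)) ` Real C X Z \<delta>"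
  by (simp add: opposite_def)

lemma biproduct_opposite [simp]:
  "biproduct (opposite C) X Y S q\<^sub>1 q\<^sub>2 j\<^sub>1 j\<^sub>2 \<longleftrightarrow> biproduct C X Y S j\<^sub>1 j\<^sub>2 q\<^sub>1 q\<^sub>2"
  unfolding biproduct_def by auto

lemma isomorphism_opposite [simp]: "isomorphism (opposite C) Y X f \<longleftrightarrow> isomorphism C X Y f"
  unfolding isomorphism_def by auto

lemma retract_opposite:
  "retract (opposite C) B' A' f' B A f \<longleftrightarrow> retract C A' B' f' A B f"
  unfolding retract_def opposite_simps by metis

lemma column_row_opposite [simp]:
  "column_mor (opposite C) X S q\<^sub>1 q\<^sub>2 a b = row_mor C S X q\<^sub>1 q\<^sub>2 a b"
  "row_mor (opposite C) S X j\<^sub>1 j\<^sub>2 a b = column_mor C X S j\<^sub>1 j\<^sub>2 a b"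
  unfolding column_mor_def row_mor_def by auto

text \<open>
  The isomorphism between the middle terms changes direction, so it has to be replaced by its
  inverse.
\<close>

lemma (in additive_bifunctor) seq_equiv_opposite:
  "((g, Y, f), (g', Y', f')) \<in> seq_equiv (opposite C) Z X \<longleftrightarrow>
    ((f, Y, g), (f', Y', g')) \<in> seq_equiv C X Z"
    (is "?L \<longleftrightarrow> ?R")
proof
  assume ?L
  then obtain b where b: "isomorphism C Y' Y b" "g \<cdot> b = g'" "b \<cdot> f' = f"
    and s: "arrow C f X Y" "arrow C g Y Z" "arrow C f' X Y'" "arrow C g' Y' Z"
    unfolding seq_equiv_def sequences_def by auto
  from b(1) obtain a where a: "isomorphism C Y Y' a" "arrow C b Y' Y" "arrow C a Y Y'"
    "a \<cdot> b = ident C Y'" "b \<cdot> a = ident C Y" by (rule isomorphism_inverse)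
  have "a \<cdot> f = f'" using comp_assoc[OF s(3) a(2,3)] b(3) a(4) comp_ident_left[OF s(3)] by simp
  moreover have "g' \<cdot> a = g"
    using comp_assoc[OF a(3,2) s(2)] b(2) a(5) comp_ident_right[OF s(2)] by simp
  ultimately show ?R using s a(1) unfolding seq_equiv_def sequences_def by auto
next
  assume ?R
  then obtain b where b: "isomorphism C Y Y' b" "b \<cdot> f = f'" "g' \<cdot> b = g"
    and s: "arrow C f X Y" "arrow C g Y Z" "arrow C f' X Y'" "arrow C g' Y' Z"
    unfolding seq_equiv_def sequences_def by auto
  from b(1) obtain a where a: "isomorphism C Y' Y a" "arrow C b Y Y'" "arrow C a Y' Y"
    "a \<cdot> b = ident C Y" "b \<cdot> a = ident C Y'" by (rule isomorphism_inverse)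
  have "a \<cdot> f' = f" using comp_assoc[OF s(1) a(2,3)] b(2) a(4) comp_ident_left[OF s(1)] by simp
  moreover have "g \<cdot> a = g'"
    using comp_assoc[OF a(3,2) s(4)] b(3) a(5) comp_ident_right[OF s(4)] by simp
  ultimately show ?L using s a(1) unfolding seq_equiv_def sequences_def by auto
qed

lemma (in additive_bifunctor) seq_equiv_class_opposite:
  "seq_equiv (opposite C) Z X `` {(g, Y, f)} =
    (\<lambda>(f, Y, g). (g, Y, f)) ` (seq_equiv C X Z `` {(f, Y, g)})"
proof -
  have "(g', Y', f') \<in> (\<lambda>(f, Y, g). (g, Y, f)) ` A \<longleftrightarrow> (f', Y', g') \<in> A"
    for f' :: 'm and Y' :: 'o and g' :: 'm and A by force
  then show ?thesis by (auto simp: seq_equiv_opposite)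
qed

lemma (in additive_bifunctor) etriangle_opposite:
  "etriangle (opposite C) (Z, g, Y, f, X, \<delta>) \<longleftrightarrow> etriangle C (X, f, Y, g, Z, \<delta>)"
proof -
  have "inj (\<lambda>(f :: 'm, Y :: 'o, g :: 'm). (g, Y, f))" by (auto simp: inj_def)
  then have "Real (opposite C) X Z \<delta> = seq_equiv (opposite C) Z X `` {(g, Y, f)} \<longleftrightarrow>
      Real C Z X \<delta> = seq_equiv C X Z `` {(f, Y, g)}"
    by (simp add: Real_opposite seq_equiv_class_opposite inj_image_eq_iff)
  then show ?thesis unfolding etriangle.simps opposite_simps by blast
qed

lemma (in additive_bifunctor) etriangle_mor_opposite:
  "etriangle_mor (opposite C) (Z', g', Y', f', X', \<delta>') (Z, g, Y, f, X, \<delta>) (\<gamma>, \<beta>, \<alpha>) \<longleftrightarrow>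
    etriangle_mor C (X, f, Y, g, Z, \<delta>) (X', f', Y', g', Z', \<delta>') (\<alpha>, \<beta>, \<gamma>)"
  by auto

lemma (in additive_bifunctor) inflation_opposite:
  "inflation (opposite C) Y X f \<longleftrightarrow> deflation C X Y f"
  "deflation (opposite C) Y X f \<longleftrightarrow> inflation C X Y f"
  unfolding inflation_def deflation_def etriangle_opposite by blast+

lemma (in additive_bifunctor) preadditive_opposite: "preadditive_category (opposite C)"
proof (rule preadditive_category.intro)
  show "comm_group (Hom (opposite C) X Y)" if "X \<in> Obj (opposite C)" "Y \<in> Obj (opposite C)" for X Y
    using hom_group that by simp
qed (unfold opposite_simps, metis ident_closed, metis comp_closed, metis comp_assoc,
    metis comp_ident_right, metis comp_ident_left, metis comp_add_right, metis comp_add_left)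

lemma opposite_extriangulated:
  assumes "extriangulated_category C"
  shows "extriangulated_category (opposite C)"
proof -
  interpret extriangulated_category C by fact
  have zo: "zero_object (opposite C) N \<longleftrightarrow> zero_object C N" for N
    unfolding zero_object_def by auto
  show ?thesis
  proof (intro extriangulated_category.intro extriangulated_category_axioms.intro
      additive_realization.intro additive_realization_axioms.intro additive_bifunctor.intro
      additive_bifunctor_axioms.intro additive_category.intro additive_category_axioms.intro
      preadditive_opposite)
    show "\<exists>N. zero_object (opposite C) N" using ex_zero_object zo by blast
    show "\<exists>S j\<^sub>1 j\<^sub>2 q\<^sub>1 q\<^sub>2. biproduct (opposite C) X Y S j\<^sub>1 j\<^sub>2 q\<^sub>1 q\<^sub>2"
      if "X \<in> Obj (opposite C)" "Y \<in> Obj (opposite C)" for X Y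
      using ex_biproduct that unfolding biproduct_opposite opposite_simps by blast
    show "comm_group (Ext (opposite C) Z X)" if "Z \<in> Obj (opposite C)" "X \<in> Obj (opposite C)" for Z X
      using ext_group that by simp
    show "Extmap (opposite C) g f \<in> hom (Ext (opposite C) Z X) (Ext (opposite C) Z' X')"
      if "arrow (opposite C) g Z' Z" "arrow (opposite C) f X X'" for g Z' Z f X X'
    proof -
      have "Extmap (opposite C) g f = Extmap C f g" by (simp add: opposite_def)
      then show ?thesis using ext_hom that by simp
    qed
    show "Extmap (opposite C) (ident (opposite C) Z) (ident (opposite C) X) \<delta> = \<delta>"
      if "extension (opposite C) \<delta> Z X" for \<delta> Z X
      using ext_ident that by simp
    show "Extmap (opposite C) (g \<cdot>\<^bsub>opposite C\<^esub> g') (f' \<cdot>\<^bsub>opposite C\<^esub> f) \<delta> =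
        Extmap (opposite C) g' f' (Extmap (opposite C) g f \<delta>)"
      if "arrow (opposite C) g Z' Z" "arrow (opposite C) g' Z'' Z'" "arrow (opposite C) f X X'"
        "arrow (opposite C) f' X' X''" "extension (opposite C) \<delta> Z X" for g Z' Z g' Z'' f X X' f' X'' \<delta>
      using ext_comp[of X' X f X'' f' Z Z' g Z'' g' \<delta>] that by simp
    show "Extmap (opposite C) (add_mor (opposite C) Z' Z g g') f \<delta> =
        Extmap (opposite C) g f \<delta> \<otimes>\<^bsub>Ext (opposite C) Z' X'\<^esub> Extmap (opposite C) g' f \<delta>"
      if "arrow (opposite C) g Z' Z" "arrow (opposite C) g' Z' Z" "arrow (opposite C) f X X'"
        "extension (opposite C) \<delta> Z X" for g Z' Z g' f X X' \<delta>
      using ext_add_co[of X' X f Z Z' g g' \<delta>] that by simp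
    show "Extmap (opposite C) g (add_mor (opposite C) X X' f f') \<delta> =
        Extmap (opposite C) g f \<delta> \<otimes>\<^bsub>Ext (opposite C) Z' X'\<^esub> Extmap (opposite C) g f' \<delta>"
      if "arrow (opposite C) g Z' Z" "arrow (opposite C) f X X'" "arrow (opposite C) f' X X'"
        "extension (opposite C) \<delta> Z X" for g Z' Z f X X' f' \<delta>
      using ext_add_contra[of X' X f f' Z Z' g \<delta>] that by simp
    show "Real (opposite C) Z X \<delta> \<in> sequences (opposite C) X Z // seq_equiv (opposite C) X Z"
      if "extension (opposite C) \<delta> Z X" for \<delta> Z X
    proof -
      have "Real C X Z \<delta> \<in> sequences C Z X // seq_equiv C Z X" using real_class that by simp
      then obtain f Y g where "(f, Y, g) \<in> sequences C Z X"
        and "Real C X Z \<delta> = seq_equiv C Z X `` {(f, Y, g)}" by (auto elim!: quotientE)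
      then have "(g, Y, f) \<in> sequences (opposite C) X Z"
        and "Real (opposite C) Z X \<delta> = seq_equiv (opposite C) X Z `` {(g, Y, f)}"
        by (auto simp: sequences_def Real_opposite seq_equiv_class_opposite)
      then show ?thesis by (auto simp: quotient_def)
    qed
    show "\<exists>\<beta>. arrow (opposite C) \<beta> Y Y' \<and> \<beta> \<cdot>\<^bsub>opposite C\<^esub> f = f' \<cdot>\<^bsub>opposite C\<^esub> \<alpha> \<and>
        g' \<cdot>\<^bsub>opposite C\<^esub> \<beta> = \<gamma> \<cdot>\<^bsub>opposite C\<^esub> g"
      if "etriangle (opposite C) (X, f, Y, g, Z, \<delta>)" "etriangle (opposite C) (X', f', Y', g', Z', \<delta>')"
        "arrow (opposite C) \<alpha> X X'" "arrow (opposite C) \<gamma> Z Z'"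
        "push (opposite C) Z \<alpha> \<delta> = pull (opposite C) X' \<gamma> \<delta>'"
      for X f Y g Z \<delta> X' f' Y' g' Z' \<delta>' \<alpha> \<gamma>
    proof -
      note e = that(1,2)[unfolded etriangle_opposite]
      have a: "arrow C \<alpha> X' X" "arrow C \<gamma> Z' Z" "push C X' \<gamma> \<delta>' = pull C Z \<alpha> \<delta>"
        using that(3-5) by simp_all
      show ?thesis using real_mor[OF e(2,1) a(2,1,3)] by auto
    qed
    show "etriangle (opposite C) (X, j\<^sub>1, S, q\<^sub>2, Z, one (Ext (opposite C) Z X))"
      if "biproduct (opposite C) X Z S j\<^sub>1 j\<^sub>2 q\<^sub>1 q\<^sub>2" for X Z S j\<^sub>1 j\<^sub>2 q\<^sub>1 q\<^sub>2
      using real_zero[OF biproduct_swap] that unfolding etriangle_opposite by simp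
    show "etriangle (opposite C)
        (S\<^sub>X, add_mor (opposite C) S\<^sub>X S\<^sub>Y (jY\<^sub>1 \<cdot>\<^bsub>opposite C\<^esub> f \<cdot>\<^bsub>opposite C\<^esub> qX\<^sub>1)
              (jY\<^sub>2 \<cdot>\<^bsub>opposite C\<^esub> f' \<cdot>\<^bsub>opposite C\<^esub> qX\<^sub>2), S\<^sub>Y,
          add_mor (opposite C) S\<^sub>Y S\<^sub>Z (jZ\<^sub>1 \<cdot>\<^bsub>opposite C\<^esub> g \<cdot>\<^bsub>opposite C\<^esub> qY\<^sub>1)
              (jZ\<^sub>2 \<cdot>\<^bsub>opposite C\<^esub> g' \<cdot>\<^bsub>opposite C\<^esub> qY\<^sub>2), S\<^sub>Z,
          Extmap (opposite C) qZ\<^sub>1 jX\<^sub>1 \<delta> \<otimes>\<^bsub>Ext (opposite C) S\<^sub>Z S\<^sub>X\<^esub> Extmap (opposite C) qZ\<^sub>2 jX\<^sub>2 \<delta>')"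
      if t: "etriangle (opposite C) (X, f, Y, g, Z, \<delta>)"
        "etriangle (opposite C) (X', f', Y', g', Z', \<delta>')"
        and b: "biproduct (opposite C) X X' S\<^sub>X jX\<^sub>1 jX\<^sub>2 qX\<^sub>1 qX\<^sub>2"
        "biproduct (opposite C) Y Y' S\<^sub>Y jY\<^sub>1 jY\<^sub>2 qY\<^sub>1 qY\<^sub>2"
        "biproduct (opposite C) Z Z' S\<^sub>Z jZ\<^sub>1 jZ\<^sub>2 qZ\<^sub>1 qZ\<^sub>2"
      for X f Y g Z \<delta> X' f' Y' g' Z' \<delta>' S\<^sub>X jX\<^sub>1 jX\<^sub>2 qX\<^sub>1 qX\<^sub>2 S\<^sub>Y jY\<^sub>1 jY\<^sub>2 qY\<^sub>1 qY\<^sub>2 S\<^sub>Z jZ\<^sub>1 jZ\<^sub>2 qZ\<^sub>1 qZ\<^sub>2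
    proof -
      note t = t[unfolded etriangle_opposite] and b = b[unfolded biproduct_opposite]
      have a: "arrow C f Y X" "arrow C f' Y' X'" "arrow C g Z Y" "arrow C g' Z' Y'" using t by auto
      note bX = biproductD[OF b(1)] and bY = biproductD[OF b(2)] and bZ = biproductD[OF b(3)]
      show ?thesis
        using real_sum[OF t b(3,2,1)] comp_assoc[OF bY(3) a(1) bX(1)] comp_assoc[OF bY(4) a(2) bX(2)]
          comp_assoc[OF bZ(3) a(3) bY(1)] comp_assoc[OF bZ(4) a(4) bY(2)]
        unfolding etriangle_opposite by (simp del: etriangle.simps)
    qed
    show "\<exists>\<gamma>. etriangle_mor (opposite C) (X, f, Y, g, Z, \<delta>) (X', f', Y', g', Z', \<delta>') (\<alpha>, \<beta>, \<gamma>)"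
      if "etriangle (opposite C) (X, f, Y, g, Z, \<delta>)" "etriangle (opposite C) (X', f', Y', g', Z', \<delta>')"
        "arrow (opposite C) \<alpha> X X'" "arrow (opposite C) \<beta> Y Y'"
        "\<beta> \<cdot>\<^bsub>opposite C\<^esub> f = f' \<cdot>\<^bsub>opposite C\<^esub> \<alpha>"
      for X f Y g Z \<delta> X' f' Y' g' Z' \<delta>' \<alpha> \<beta>
    proof -
      note e = that(1,2)[unfolded etriangle_opposite]
      have a: "arrow C \<alpha> X' X" "arrow C \<beta> Y' Y" "\<alpha> \<cdot>\<^bsub>C\<^esub> f' = f \<cdot>\<^bsub>C\<^esub> \<beta>" using that(3-5) by simp_all
      show ?thesis using ET3_op[OF e(2,1) a(2,1,3)] unfolding etriangle_mor_opposite by blast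
    qed
    show "\<exists>\<alpha>. etriangle_mor (opposite C) (X, f, Y, g, Z, \<delta>) (X', f', Y', g', Z', \<delta>') (\<alpha>, \<beta>, \<gamma>)"
      if "etriangle (opposite C) (X, f, Y, g, Z, \<delta>)" "etriangle (opposite C) (X', f', Y', g', Z', \<delta>')"
        "arrow (opposite C) \<beta> Y Y'" "arrow (opposite C) \<gamma> Z Z'"
        "\<gamma> \<cdot>\<^bsub>opposite C\<^esub> g = g' \<cdot>\<^bsub>opposite C\<^esub> \<beta>"
      for X f Y g Z \<delta> X' f' Y' g' Z' \<delta>' \<beta> \<gamma>
    proof -
      note e = that(1,2)[unfolded etriangle_opposite]
      have a: "arrow C \<gamma> Z' Z" "arrow C \<beta> Y' Y" "\<beta> \<cdot>\<^bsub>C\<^esub> g' = g \<cdot>\<^bsub>C\<^esub> \<gamma>" using that(3-5) by simp_all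
      show ?thesis using ET3[OF e(2,1) a(1,2,3)] unfolding etriangle_mor_opposite by blast
    qed
    show "\<exists>m h F \<theta> w q \<eta>.
        etriangle (opposite C) (A, m, M, h, F, \<theta>) \<and> etriangle (opposite C) (D, w, F, q, E, \<eta>) \<and>
        m = u \<cdot>\<^bsub>opposite C\<^esub> f \<and> w \<cdot>\<^bsub>opposite C\<^esub> g = h \<cdot>\<^bsub>opposite C\<^esub> u \<and> v = q \<cdot>\<^bsub>opposite C\<^esub> h \<and>
        pull (opposite C) A w \<theta> = \<delta> \<and> push (opposite C) E g \<epsilon> = \<eta> \<and>
        push (opposite C) F f \<theta> = pull (opposite C) B q \<epsilon>"
      if "etriangle (opposite C) (A, f, B, g, D, \<delta>)" "etriangle (opposite C) (B, u, M, v, E, \<epsilon>)"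
      for A f B g D \<delta> u M v E \<epsilon>
    proof -
      have "etriangle C (E, v, M, u, B, \<epsilon>)" "etriangle C (D, g, B, f, A, \<delta>)"
        using that unfolding etriangle_opposite by auto
      from ET4_op[OF this] show ?thesis unfolding etriangle_opposite opposite_simps by metis
    qed
    show "\<exists>f B g \<delta> u v \<epsilon>.
        etriangle (opposite C) (A, f, B, g, D, \<delta>) \<and> etriangle (opposite C) (B, u, M, v, E, \<epsilon>) \<and>
        m = u \<cdot>\<^bsub>opposite C\<^esub> f \<and> w \<cdot>\<^bsub>opposite C\<^esub> g = h \<cdot>\<^bsub>opposite C\<^esub> u \<and> v = q \<cdot>\<^bsub>opposite C\<^esub> h \<and>
        pull (opposite C) A w \<theta> = \<delta> \<and> push (opposite C) E g \<epsilon> = \<eta> \<and>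
        push (opposite C) F f \<theta> = pull (opposite C) B q \<epsilon>"
      if "etriangle (opposite C) (A, m, M, h, F, \<theta>)" "etriangle (opposite C) (D, w, F, q, E, \<eta>)"
      for A m M h F \<theta> D w q E \<eta>
    proof -
      have "etriangle C (E, q, F, w, D, \<eta>)" "etriangle C (F, h, M, m, A, \<theta>)"
        using that unfolding etriangle_opposite by auto
      from ET4[OF this] show ?thesis unfolding etriangle_opposite opposite_simps by metis
    qed
  qed
qed

section \<open>Exactness properties of an \<open>\<bbbE>\<close>-triangle\<close>

context extriangulated_category
begin

lemmas op_ext = opposite_extriangulated[OF extriangulated_category_axioms]

lemma etriangleD:
  assumes "etriangle C (X, f, Y, g, Z, \<delta>)"
  shows "arrow C f X Y" "arrow C g Y Z" "extension C \<delta> Z X"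
  using assms by auto

lemma equiv_seq_equiv: "equiv (sequences C X Z) (seq_equiv C X Z)"
proof (rule equivI)
  show "seq_equiv C X Z \<subseteq> sequences C X Z \<times> sequences C X Z"
    unfolding seq_equiv_def by auto
  show "refl_on (sequences C X Z) (seq_equiv C X Z)"
  proof (rule refl_onI, clarify)
    fix f Y g assume s: "(f, Y, g) \<in> sequences C X Z"
    then have a: "arrow C f X Y" "arrow C g Y Z" unfolding sequences_def by auto
    note i = ident_mor[OF conjunct1[OF a(2)]]
    have "isomorphism C Y Y (ident C Y)" using isomorphismI[OF i i] comp_ident_left[OF i] by blast
    then show "((f, Y, g), (f, Y, g)) \<in> seq_equiv C X Z"
      using s comp_ident_left[OF a(1)] comp_ident_right[OF a(2)] unfolding seq_equiv_def by blast
  qed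
  show "sym (seq_equiv C X Z)"
  proof (rule symI, clarify)
    fix f Y g f' Y' g' assume "((f, Y, g), (f', Y', g')) \<in> seq_equiv C X Z"
    then obtain b where b: "isomorphism C Y Y' b" "b \<cdot> f = f'" "g' \<cdot> b = g"
      and s: "arrow C f X Y" "arrow C g Y Z" "arrow C f' X Y'" "arrow C g' Y' Z"
      unfolding seq_equiv_def sequences_def by auto
    from b(1) obtain a where a: "isomorphism C Y' Y a" "arrow C b Y Y'" "arrow C a Y' Y"
      "a \<cdot> b = ident C Y" "b \<cdot> a = ident C Y'" by (rule isomorphism_inverse)
    have "a \<cdot> f' = f" using comp_assoc[OF s(1) a(2,3)] b(2) a(4) comp_ident_left[OF s(1)] by simp
    moreover have "g \<cdot> a = g'"
      using comp_assoc[OF a(3,2) s(4)] b(3) a(5) comp_ident_right[OF s(4)] by simp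
    ultimately show "((f', Y', g'), (f, Y, g)) \<in> seq_equiv C X Z"
      using s a(1) unfolding seq_equiv_def sequences_def by auto
  qed
  show "trans (seq_equiv C X Z)"
  proof (rule transI, clarify)
    fix f Y g f' Y' g' f'' Y'' g''
    assume "((f, Y, g), (f', Y', g')) \<in> seq_equiv C X Z" "((f', Y', g'), (f'', Y'', g'')) \<in> seq_equiv C X Z"
    then obtain b c where b: "isomorphism C Y Y' b" "b \<cdot> f = f'" "g' \<cdot> b = g"
      and c: "isomorphism C Y' Y'' c" "c \<cdot> f' = f''" "g'' \<cdot> c = g'"
      and s: "arrow C f X Y" "arrow C g Y Z" "arrow C f'' X Y''" "arrow C g'' Y'' Z"
      unfolding seq_equiv_def sequences_def by auto
    have a: "arrow C b Y Y'" "arrow C c Y' Y''" using b(1) c(1) unfolding isomorphism_def by auto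
    have "(c \<cdot> b) \<cdot> f = f''" using comp_assoc[OF s(1) a] b c by simp
    moreover have "g'' \<cdot> (c \<cdot> b) = g" using comp_assoc[OF a s(4)] b c by simp
    ultimately show "((f, Y, g), (f'', Y'', g'')) \<in> seq_equiv C X Z"
      using s isomorphism_comp[OF b(1) c(1)] unfolding seq_equiv_def sequences_def by auto
  qed
qed

lemma etriangle_change_middle:
  assumes t: "etriangle C (X, f, Y, g, Z, \<delta>)" and b: "isomorphism C Y Y' b"
    and g': "arrow C g' Y' Z" and e: "b \<cdot> f = f'" "g' \<cdot> b = g"
  shows "etriangle C (X, f', Y', g', Z, \<delta>)"
proof -
  note a = etriangleD[OF t]
  have ba: "arrow C b Y Y'" using b unfolding isomorphism_def by auto
  have f': "arrow C f' X Y'" using comp_closed[OF a(1) ba] e by simp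
  have "((f, Y, g), (f', Y', g')) \<in> seq_equiv C X Z"
    using a b g' f' e unfolding seq_equiv_def sequences_def by auto
  from equiv_class_eq[OF equiv_seq_equiv this] show ?thesis using t f' g' by simp
qed

lemma zero_object_unique:
  assumes N: "zero_object C N"
  shows "arrow C f X N \<Longrightarrow> f = zero_mor C X N" "arrow C f N X \<Longrightarrow> f = zero_mor C N X"
  using N zero_closed unfolding zero_object_def by metis+

lemma biproduct_zero_object:
  assumes N: "zero_object C N" and X: "X \<in> Obj C"
  shows "biproduct C X N X (ident C X) (zero_mor C N X) (ident C X) (zero_mor C X N)"
proof -
  have NO: "N \<in> Obj C" using N by (simp add: zero_object_def)
  note z = zero_closed[OF X NO] zero_closed[OF NO X] and i = ident_mor[OF X]
  show ?thesis unfolding biproduct_def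
    using z i NO comp_ident_left[OF i] comp_ident_left[OF z(2)] comp_ident_right[OF z(1)]
      comp_zero_left[OF z(2) NO] comp_zero_left[OF z(1) X] add_zero[OF i]
      zero_object_unique(1)[OF N ident_mor[OF NO]] by simp
qed

lemma etriangle_left_zero:
  assumes "zero_object C N" "T \<in> Obj C"
  shows "etriangle C (N, zero_mor C N T, T, ident C T, T, one (Ext C T N))"
  using real_zero[OF biproduct_swap[OF biproduct_zero_object[OF assms]]] .

lemma etriangle_right_zero:
  assumes "zero_object C N" "T \<in> Obj C"
  shows "etriangle C (T, ident C T, T, zero_mor C T N, N, one (Ext C N T))"
  using real_zero[OF biproduct_zero_object[OF assms]] .

lemma etriangle_comp_zero:
  assumes t: "etriangle C (X, f, Y, g, Z, \<delta>)"
  shows "g \<cdot> f = zero_mor C X Z"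
proof -
  obtain N where N: "zero_object C N" using ex_zero_object by blast
  note a = etriangleD[OF t]
  have X: "X \<in> Obj C" using a by blast
  obtain \<gamma> where "etriangle_mor C (X, ident C X, X, zero_mor C X N, N, one (Ext C N X))
      (X, f, Y, g, Z, \<delta>) (ident C X, f, \<gamma>)"
    using ET3[OF etriangle_right_zero[OF N X] t ident_mor[OF X] a(1) refl] by blast
  then have "g \<cdot> f = \<gamma> \<cdot> zero_mor C X N" "arrow C \<gamma> N Z" by simp_all
  then show ?thesis using comp_zero_right X by simp
qed

text \<open>
  (ET3) applied to the morphism \<open>(0, h)\<close> to the trivial \<open>\<bbbE>\<close>-triangle \<open>0 \<rightarrow> T \<rightarrow> T\<close>.  The factorization
  need not be unique: inflations and deflations are only weak kernels and weak cokernels of each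
  other.
\<close>

lemma factor_through_deflation:
  assumes t: "etriangle C (X, f, Y, g, Z, \<delta>)" and h: "arrow C h Y T" "h \<cdot> f = zero_mor C X T"
  shows "\<exists>u. arrow C u Z T \<and> u \<cdot> g = h"
proof -
  obtain N where N: "zero_object C N" using ex_zero_object by blast
  note a = etriangleD[OF t]
  have T: "T \<in> Obj C" and X: "X \<in> Obj C" and NO: "N \<in> Obj C"
    using h a N by (auto simp: zero_object_def)
  have "h \<cdot> f = zero_mor C N T \<cdot> zero_mor C X N"
    using h comp_zero_right[OF zero_closed[OF NO T] X] by simp
  from ET3[OF t etriangle_left_zero[OF N T] zero_closed[OF X NO] h(1) this]
  show ?thesis using comp_ident_left[OF h(1)] by auto
qed

lemma factor_through_inflation:
  assumes t: "etriangle C (X, f, Y, g, Z, \<delta>)" and h: "arrow C h T Y" "g \<cdot> h = zero_mor C T Z"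
  shows "\<exists>u. arrow C u T X \<and> f \<cdot> u = h"
  using extriangulated_category.factor_through_deflation[OF op_ext,
      of Z g Y f X \<delta> T h] t h unfolding etriangle_opposite opposite_simps by blast

text \<open>
  (ET3) applied to the morphism \<open>(f, 1)\<close> to the trivial \<open>\<bbbE>\<close>-triangle \<open>Y \<rightarrow> Y \<rightarrow> 0\<close>, whose extension
  is zero.
\<close>

lemma push_inflation:
  assumes t: "etriangle C (X, f, Y, g, Z, \<delta>)"
  shows "push C Z f \<delta> = one (Ext C Z Y)"
proof -
  obtain N where N: "zero_object C N" using ex_zero_object by blast
  note a = etriangleD[OF t]
  have Y: "Y \<in> Obj C" using a by blast
  obtain \<gamma> where "etriangle_mor C (X, f, Y, g, Z, \<delta>)
      (Y, ident C Y, Y, zero_mor C Y N, N, one (Ext C N Y)) (f, ident C Y, \<gamma>)"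
    using ET3[OF t etriangle_right_zero[OF N Y] a(1) ident_mor[OF Y] refl] by blast
  then have "push C Z f \<delta> = pull C Y \<gamma> (one (Ext C N Y))" "arrow C \<gamma> Z N" by simp_all
  then show ?thesis using pull_one Y by simp
qed

lemma pull_deflation:
  assumes t: "etriangle C (X, f, Y, g, Z, \<delta>)"
  shows "pull C X g \<delta> = one (Ext C Y X)"
  using extriangulated_category.push_inflation[OF op_ext, of Z g Y f X \<delta>] t
  unfolding etriangle_opposite opposite_simps by blast

text \<open>
  The extension \<open>n\<^sub>* \<delta>\<close> is the obstruction to extending \<open>n\<close>: if it vanishes, \<open>n\<close> and \<open>Z \<rightarrow> 0\<close> satisfy
  the compatibility required for a morphism to the trivial \<open>\<bbbE>\<close>-triangle \<open>T \<rightarrow> T \<rightarrow> 0\<close>.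
\<close>

lemma extend_along_inflation:
  assumes t: "etriangle C (X, f, Y, g, Z, \<delta>)" and n: "arrow C n X T" "push C Z n \<delta> = one (Ext C Z T)"
  shows "\<exists>m. arrow C m Y T \<and> m \<cdot> f = n"
proof -
  obtain N where N: "zero_object C N" using ex_zero_object by blast
  note a = etriangleD[OF t]
  have T: "T \<in> Obj C" and Z: "Z \<in> Obj C" and NO: "N \<in> Obj C"
    using n a N by (auto simp: zero_object_def)
  note z = zero_closed[OF Z NO]
  have "push C Z n \<delta> = pull C T (zero_mor C Z N) (one (Ext C N T))"
    using pull_one[OF z T] n by simp
  from real_mor[OF t etriangle_right_zero[OF N T] n(1) z this]
  show ?thesis using comp_ident_left[OF n(1)] by auto
qed

lemma lift_along_deflation:
  assumes t: "etriangle C (X, f, Y, g, Z, \<delta>)" and n: "arrow C n T Z" "pull C X n \<delta> = one (Ext C T X)"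
  shows "\<exists>m. arrow C m T Y \<and> g \<cdot> m = n"
  using extriangulated_category.extend_along_inflation[OF op_ext, of Z g Y f X \<delta> T n] t n
  unfolding etriangle_opposite opposite_simps by blast

text \<open>
  Put \<open>n = u - 1\<close>.  Then \<open>n\<^sub>* \<delta> = 0\<close>, so \<open>n = m f\<close> for some \<open>m\<close>, while \<open>f n = 0\<close>; thus
  \<open>n n = m f n = 0\<close>.
\<close>

lemma fibre_endo_square_zero:
  assumes t: "etriangle C (X, f, Y, g, Z, \<delta>)" and u: "arrow C u X X"
    and e: "f \<cdot> u = f" "push C Z u \<delta> = \<delta>"
    and n: "n = add_mor C X X u (neg_mor C X X (ident C X))"
  shows "n \<cdot> n = zero_mor C X X"
proof -
  note a = etriangleD[OF t]
  have X: "X \<in> Obj C" and Z: "Z \<in> Obj C" using u a by auto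
  note i = ident_mor[OF X]
  note ni = neg_closed[OF i]
  have n1: "arrow C n X X" unfolding n using add_closed[OF u ni] .
  have fn: "f \<cdot> n = zero_mor C X Y"
    unfolding n using comp_add_right[OF u ni a(1)] comp_neg_right[OF i a(1)] e(1)
      comp_ident_right[OF a(1)] add_neg[OF a(1)] by simp
  have "push C Z n \<delta> = one (Ext C Z X)"
  proof -
    interpret comm_group "Ext C Z X" using ext_group X Z by blast
    show ?thesis unfolding n
      using push_add[OF u ni a(3)] push_neg[OF i a(3)] push_ident[OF a(3)] e(2) a(3) by simp
  qed
  then obtain m where m: "arrow C m Y X" "m \<cdot> f = n" using extend_along_inflation[OF t n1] by blast
  have "n \<cdot> n = m \<cdot> (f \<cdot> n)" using comp_assoc[OF n1 a(1) m(1)] m(2) by simp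
  then show ?thesis using fn comp_zero_right[OF m(1) X] by simp
qed

text \<open>
  The comparison morphisms supplied by (ET3op) in both directions compose to endomorphisms \<open>u\<close> as in
  \<open>fibre_endo_square_zero\<close>, hence to unipotent ones.  This replaces an appeal to the five lemma, for
  which the exact sequences are too short on the left.
\<close>

lemma same_deflation:
  assumes t: "etriangle C (X, f, Y, g, Z, \<delta>)" and t': "etriangle C (X', f', Y, g, Z, \<delta>')"
  shows "\<exists>a. isomorphism C X X' a \<and> f' \<cdot> a = f \<and> push C Z a \<delta> = \<delta>'"
proof -
  note d = etriangleD[OF t] and d' = etriangleD[OF t']
  have O: "X \<in> Obj C" "X' \<in> Obj C" "Y \<in> Obj C" "Z \<in> Obj C" using d d' by auto
  note i = ident_mor[OF O(3)] ident_mor[OF O(4)]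
  have e: "ident C Z \<cdot> g = g \<cdot> ident C Y" using comp_ident_left[OF d(2)] comp_ident_right[OF d(2)] by simp
  obtain a where "etriangle_mor C (X, f, Y, g, Z, \<delta>) (X', f', Y, g, Z, \<delta>') (a, ident C Y, ident C Z)"
    using ET3_op[OF t t' i e] by blast
  then have a: "arrow C a X X'" "f' \<cdot> a = f" "push C Z a \<delta> = \<delta>'"
    using comp_ident_left[OF d(1)] pull_ident[OF d'(3)] by simp_all
  obtain b where "etriangle_mor C (X', f', Y, g, Z, \<delta>') (X, f, Y, g, Z, \<delta>) (b, ident C Y, ident C Z)"
    using ET3_op[OF t' t i e] by blast
  then have b: "arrow C b X' X" "f \<cdot> b = f'" "push C Z b \<delta>' = \<delta>"
    using comp_ident_left[OF d'(1)] pull_ident[OF d(3)] by simp_all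
  have "f \<cdot> (b \<cdot> a) = f" "push C Z (b \<cdot> a) \<delta> = \<delta>"
    using comp_assoc[OF a(1) b(1) d(1)] push_comp[OF a(1) b(1) d(3)] a b by simp_all
  note n = fibre_endo_square_zero[OF t comp_closed[OF a(1) b(1)] this refl]
  have "f' \<cdot> (a \<cdot> b) = f'" "push C Z (a \<cdot> b) \<delta>' = \<delta>'"
    using comp_assoc[OF b(1) a(1) d'(1)] push_comp[OF b(1) a(1) d'(3)] a b by simp_all
  note m = fibre_endo_square_zero[OF t' comp_closed[OF b(1) a(1)] this refl]
  have "isomorphism C X X' a" by (rule iso_of_unipotent[OF a(1) b(1) refl n refl m])
  then show ?thesis using a by blast
qed

lemma same_inflation:
  assumes t: "etriangle C (X, f, Y, g, Z, \<delta>)" and t': "etriangle C (X, f, Y, g', Z', \<delta>')"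
  shows "\<exists>c. isomorphism C Z' Z c \<and> c \<cdot> g' = g \<and> pull C X c \<delta> = \<delta>'"
  using extriangulated_category.same_deflation[OF op_ext, of Z g Y f X \<delta> Z' g' \<delta>'] t t'
  unfolding etriangle_opposite opposite_simps isomorphism_opposite by blast

text \<open>
  The idempotent \<open>1 - s g\<close> is killed by \<open>g\<close>, hence equals \<open>f r\<close>, and
  the remaining biproduct identities follow because \<open>f\<close> is a split monomorphism.
\<close>

lemma zero_extension_splits:
  assumes t: "etriangle C (X, f, Y, g, Z, one (Ext C Z X))"
    and s: "arrow C s Z Y" "g \<cdot> s = ident C Z"
  shows "\<exists>r. biproduct C X Z Y f s r g"
proof -
  note a = etriangleD[OF t]
  have O: "X \<in> Obj C" "Y \<in> Obj C" "Z \<in> Obj C" using a by auto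
  note iX = ident_mor[OF O(1)] and iY = ident_mor[OF O(2)]
  obtain r0 where r0: "arrow C r0 Y X" "r0 \<cdot> f = ident C X"
    using extend_along_inflation[OF t iX push_ident] a(3) by blast
  have mono: "h = k" if h: "arrow C h T X" and k: "arrow C k T X" and e: "f \<cdot> h = f \<cdot> k" for h k T
  proof -
    have "h = r0 \<cdot> (f \<cdot> h)" by (simp only: comp_assoc[OF h a(1) r0(1)] r0(2) comp_ident_left[OF h])
    also have "\<dots> = k"
      by (simp only: e comp_assoc[OF k a(1) r0(1)] r0(2) comp_ident_left[OF k])
    finally show ?thesis .
  qed
  note sg = comp_closed[OF a(2) s(1)]
  note nsg = neg_closed[OF sg]
  let ?h = "add_mor C Y Y (ident C Y) (neg_mor C Y Y (s \<cdot> g))"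
  have h: "arrow C ?h Y Y" using add_closed[OF iY nsg] .
  have "g \<cdot> ?h = zero_mor C Y Z"
    using comp_add_right[OF iY nsg a(2)] comp_neg_right[OF sg a(2)] comp_assoc[OF a(2) s(1) a(2)]
      s(2) comp_ident_left[OF a(2)] comp_ident_right[OF a(2)] add_neg[OF a(2)] by simp
  then obtain r where r: "arrow C r Y X" "f \<cdot> r = ?h" using factor_through_inflation[OF t h] by blast
  note gf = etriangle_comp_zero[OF t]
  have sgf: "s \<cdot> g \<cdot> f = zero_mor C X Y"
    using comp_assoc[OF a(1,2) s(1), symmetric] comp_zero_right[OF s(1) O(1)]
    unfolding gf by (rule trans)
  have sgs: "s \<cdot> g \<cdot> s = s"
    using comp_assoc[OF s(1) a(2) s(1), symmetric] comp_ident_right[OF s(1)]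
    unfolding s(2) by (rule trans)
  have rf: "r \<cdot> f = ident C X"
  proof (rule mono[OF comp_closed[OF a(1) r(1)] iX])
    show "f \<cdot> (r \<cdot> f) = f \<cdot> ident C X"
      using comp_assoc[OF a(1) r(1) a(1)] r(2) comp_add_left[OF a(1) iY nsg] comp_neg_left[OF a(1) sg]
        sgf neg_zero[OF O(1,2)]
        comp_ident_left[OF a(1)] comp_ident_right[OF a(1)] add_zero[OF a(1)] by simp
  qed
  have rs: "r \<cdot> s = zero_mor C Z X"
  proof (rule mono[OF comp_closed[OF s(1) r(1)] zero_closed[OF O(3,1)]])
    show "f \<cdot> (r \<cdot> s) = f \<cdot> zero_mor C Z X"
      using comp_assoc[OF s(1) r(1) a(1)] r(2) comp_add_left[OF s(1) iY nsg] comp_neg_left[OF s(1) sg]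
        sgs comp_zero_right[OF a(1) O(3)]
        comp_ident_left[OF s(1)] comp_ident_right[OF s(1)] add_neg[OF s(1)] by simp
  qed
  have "add_mor C Y Y (f \<cdot> r) (s \<cdot> g) = ident C Y"
    by (simp only: r(2) add_assoc_mor[OF iY nsg sg] add_neg[OF sg] add_zero[OF iY])
  then show ?thesis unfolding biproduct_def using a(1,2) r(1) s rf rs gf by blast
qed

end

section \<open>Homotopy pullbacks and pushouts\<close>

context extriangulated_category
begin

text \<open>
  The direct sum with the trivial \<open>\<bbbE>\<close>-triangle \<open>0 \<rightarrow> W \<rightarrow> W\<close>, with \<open>X\<close> serving as its own direct sum with
  the zero object.
\<close>

lemma etriangle_add_right:
  assumes t: "etriangle C (X, f, Y, g, Z, \<delta>)"
    and bY: "biproduct C Y W S j\<^sub>1 j\<^sub>2 q\<^sub>1 q\<^sub>2" and bZ: "biproduct C Z W S' j\<^sub>1' j\<^sub>2' q\<^sub>1' q\<^sub>2'"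
  shows "etriangle C (X, j\<^sub>1 \<cdot> f, S, column_mor C S S' j\<^sub>1' j\<^sub>2' (g \<cdot> q\<^sub>1) q\<^sub>2, S', pull C X q\<^sub>1' \<delta>)"
proof -
  obtain N where N: "zero_object C N" using ex_zero_object by blast
  note a = etriangleD[OF t] and bYD = biproductD[OF bY] and bZD = biproductD[OF bZ]
  have O: "X \<in> Obj C" "W \<in> Obj C" "S \<in> Obj C" "S' \<in> Obj C" "N \<in> Obj C"
    using a(1) bYD(2) bZD(2) conjunct1[OF N[unfolded zero_object_def]] by simp_all
  note z = zero_closed[OF O(5,2)] and z' = zero_closed[OF O(1,5)] and z'' = zero_closed[OF O(5,1)]
  have e1: "add_mor C X S (j\<^sub>1 \<cdot> f \<cdot> ident C X) (j\<^sub>2 \<cdot> zero_mor C N W \<cdot> zero_mor C X N) = j\<^sub>1 \<cdot> f"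
    using comp_ident_right[OF comp_closed[OF a(1) bYD(1)]] comp_zero_right[OF bYD(2) O(5)]
      comp_zero_left[OF z' O(3)] add_zero[OF comp_closed[OF a(1) bYD(1)]] by simp
  have e2: "add_mor C S S' (j\<^sub>1' \<cdot> g \<cdot> q\<^sub>1) (j\<^sub>2' \<cdot> ident C W \<cdot> q\<^sub>2) =
      column_mor C S S' j\<^sub>1' j\<^sub>2' (g \<cdot> q\<^sub>1) q\<^sub>2"
    unfolding column_mor_def
    using comp_assoc[OF bYD(3) a(2) bZD(1)] comp_ident_right[OF bZD(2)] by simp
  have e3: "Extmap C q\<^sub>1' (ident C X) \<delta> \<otimes>\<^bsub>Ext C S' X\<^esub> Extmap C q\<^sub>2' (zero_mor C N X) (one (Ext C W N)) =
      pull C X q\<^sub>1' \<delta>"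
    using Extmap_one[OF bZD(4) z''] ext_add_zero(1)[OF pull_closed[OF bZD(3) a(3)]]
    unfolding pull_def by simp
  show ?thesis
    using real_sum[OF t etriangle_left_zero[OF N O(2)] biproduct_zero_object[OF N O(1)] bY bZ]
    unfolding e1 e2 e3 .
qed

lemma etriangle_add_left:
  assumes t: "etriangle C (X, f, Y, g, Z, \<delta>)"
    and bX: "biproduct C X W S j\<^sub>1 j\<^sub>2 q\<^sub>1 q\<^sub>2" and bY: "biproduct C Y W S' j\<^sub>1' j\<^sub>2' q\<^sub>1' q\<^sub>2'"
  shows "etriangle C (S, row_mor C S S' q\<^sub>1 q\<^sub>2 (j\<^sub>1' \<cdot> f) j\<^sub>2', S', g \<cdot> q\<^sub>1', Z, push C Z j\<^sub>1 \<delta>)"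
proof -
  have "etriangle (opposite C) (Z, g, Y, f, X, \<delta>)"
    "biproduct (opposite C) Y W S' q\<^sub>1' q\<^sub>2' j\<^sub>1' j\<^sub>2'" "biproduct (opposite C) X W S q\<^sub>1 q\<^sub>2 j\<^sub>1 j\<^sub>2"
    using t bX bY by (simp_all only: etriangle_opposite biproduct_opposite)
  from extriangulated_category.etriangle_add_right[OF op_ext this]
  show ?thesis by (simp only: etriangle_opposite opposite_simps column_row_opposite)
qed

text \<open>
  The object \<open>P\<close> is a homotopy pullback of \<open>y\<close> and \<open>z\<close>.  The deflation \<open>y q\<^sub>1 - z q\<^sub>2\<close> is the composite of
  \<open>y \<oplus> 1 : Q \<oplus> X \<rightarrow> Z \<oplus> X\<close> and the split deflation \<open>(1, -z) : Z \<oplus> X \<rightarrow> Z\<close> with fibre \<open>(z, 1)\<close>;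
  (ET4op) for this composite yields both \<open>\<bbbE>\<close>-triangles.  The morphism \<open>z'\<close> stands for \<open>-z\<close>; it is kept
  as a variable so that either of the two can be given without a sign.
\<close>

lemma homotopy_pullback:
  assumes t: "etriangle C (K, j, Q, y, Z, \<zeta>)" and z: "arrow C z X Z" and z': "arrow C z' X Z"
    and zz: "add_mor C X Z z z' = zero_mor C X Z" and b: "biproduct C Q X S j\<^sub>1 j\<^sub>2 q\<^sub>1 q\<^sub>2"
  shows "\<exists>P \<phi> \<pi> \<iota>. etriangle C (K, \<phi>, P, \<pi>, X, pull C K z \<zeta>) \<and>
    etriangle C (P, \<iota>, S, row_mor C S Z q\<^sub>1 q\<^sub>2 y z', Z, push C Z \<phi> \<zeta>) \<and>
    \<iota> \<cdot> \<phi> = j\<^sub>1 \<cdot> j \<and> q\<^sub>2 \<cdot> \<iota> = \<pi>"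
proof -
  note d = etriangleD[OF t] and bD = biproductD[OF b]
  have O: "X \<in> Obj C" "Z \<in> Obj C" "K \<in> Obj C" using d z by auto
  obtain S' a\<^sub>1 a\<^sub>2 b\<^sub>1 b\<^sub>2 where c: "biproduct C Z X S' a\<^sub>1 a\<^sub>2 b\<^sub>1 b\<^sub>2"
    using ex_biproduct O by blast
  note cD = biproductD[OF c]
  let ?G = "column_mor C S S' a\<^sub>1 a\<^sub>2 (y \<cdot> q\<^sub>1) q\<^sub>2"
  note yq = comp_closed[OF bD(3) d(2)]
  note G = column_comp[OF c yq bD(4)]
  have tG: "etriangle C (K, j\<^sub>1 \<cdot> j, S, ?G, S', pull C K b\<^sub>1 \<zeta>)"
    using etriangle_add_right[OF t b c] .
  let ?w = "add_mor C X S' (a\<^sub>1 \<cdot> z) a\<^sub>2" and ?q = "add_mor C S' Z b\<^sub>1 (neg_mor C S' Z (z \<cdot> b\<^sub>2))"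
  note sh = biproduct_shear[OF c z]
  note shD = biproductD[OF sh]
  have tw: "etriangle C (X, ?w, S', ?q, Z, one (Ext C Z X))"
    using real_zero[OF biproduct_swap[OF sh]] .
  obtain \<phi> P \<pi> \<delta> \<iota> \<xi> where h: "etriangle C (K, \<phi>, P, \<pi>, X, \<delta>)"
    "etriangle C (P, \<iota>, S, ?q \<cdot> ?G, Z, \<xi>)" "j\<^sub>1 \<cdot> j = \<iota> \<cdot> \<phi>" "?w \<cdot> \<pi> = ?G \<cdot> \<iota>"
    "pull C K ?w (pull C K b\<^sub>1 \<zeta>) = \<delta>"
    "push C S' \<phi> (pull C K b\<^sub>1 \<zeta>) = pull C P ?q \<xi>"
    using ET4_op[OF tG tw] by metis
  note h1 = etriangleD[OF h(1)] and h2 = etriangleD[OF h(2)]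
  have z'': "neg_mor C X Z z = z'" using neg_unique[OF z z' zz] by simp
  note zb = comp_closed[OF cD(4) z]
  have row: "?q \<cdot> ?G = row_mor C S Z q\<^sub>1 q\<^sub>2 y z'"
    unfolding row_mor_def
    using comp_add_left[OF G(1) cD(3) neg_closed[OF zb]] comp_neg_left[OF G(1) zb]
      comp_assoc[OF G(1) cD(4) z] G(2,3) comp_neg_left[OF bD(4) z] z'' by simp
  have wc: "b\<^sub>1 \<cdot> ?w = z" "b\<^sub>2 \<cdot> ?w = ident C X"
    using column_comp[OF c z ident_mor[OF O(1)]] comp_ident_right[OF cD(2)]
    unfolding column_mor_def by simp_all
  have pi: "q\<^sub>2 \<cdot> \<iota> = \<pi>"
    using comp_assoc[OF h1(2) shD(2) cD(4)] wc(2) comp_ident_left[OF h1(2)]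
      comp_assoc[OF h2(1) G(1) cD(4)] G(3) h(4) by simp
  have \<delta>: "\<delta> = pull C K z \<zeta>" using h(5) pull_comp[OF cD(3) shD(2) d(3)] wc(1) by simp
  have "pull C P a\<^sub>1 (pull C P ?q \<xi>) = \<xi>"
    using pull_comp[OF shD(3) cD(1) h2(3)] shD(5) pull_ident[OF h2(3)] by simp
  moreover have "pull C P a\<^sub>1 (push C S' \<phi> (pull C K b\<^sub>1 \<zeta>)) = push C Z \<phi> \<zeta>"
    using push_pull[OF cD(1) h1(1) pull_closed[OF cD(3) d(3)]] pull_comp[OF cD(3) cD(1) d(3)]
      cD(5) pull_ident[OF d(3)] by simp
  ultimately have "\<xi> = push C Z \<phi> \<zeta>" using h(6) by simp
  then show ?thesis using h(1,2,3) \<delta> pi unfolding row by metis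
qed

lemma homotopy_pushout:
  assumes t: "etriangle C (Z, y, Q, j, K, \<zeta>)" and z: "arrow C z Z X" and z': "arrow C z' Z X"
    and zz: "add_mor C Z X z z' = zero_mor C Z X" and b: "biproduct C Q X S j\<^sub>1 j\<^sub>2 q\<^sub>1 q\<^sub>2"
  shows "\<exists>P \<phi> \<pi> \<iota>. etriangle C (X, \<pi>, P, \<phi>, K, push C K z \<zeta>) \<and>
    etriangle C (Z, column_mor C Z S j\<^sub>1 j\<^sub>2 y z', S, \<iota>, P, pull C Z \<phi> \<zeta>) \<and>
    \<phi> \<cdot> \<iota> = j \<cdot> q\<^sub>1 \<and> \<iota> \<cdot> j\<^sub>2 = \<pi>"
proof -
  have "etriangle (opposite C) (K, j, Q, y, Z, \<zeta>)" "arrow (opposite C) z X Z" "arrow (opposite C) z' X Z"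
    "add_mor (opposite C) X Z z z' = zero_mor (opposite C) X Z"
    "biproduct (opposite C) Q X S q\<^sub>1 q\<^sub>2 j\<^sub>1 j\<^sub>2"
    using assms by (simp_all only: etriangle_opposite biproduct_opposite opposite_simps simp_thms)
  from extriangulated_category.homotopy_pullback[OF op_ext this]
  show ?thesis unfolding etriangle_opposite opposite_simps column_row_opposite by metis
qed

end

section \<open>Factoring a deflation through an inflation\<close>

context extriangulated_category
begin

text \<open>
  This is the octahedron for a deflation \<open>z\<close> that factors as an inflation \<open>x\<close> followed by a deflation
  \<open>y\<close>.  (ET4) and (ET4op) treat only composites of two inflations or of two deflations.

  The homotopy pullback of \<open>z\<close> and \<open>-y\<close> is \<open>U = X \<oplus> K\<close>, because \<open>(z, y) = y (x, 1)\<close> is the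
  projection to \<open>Q\<close> followed by \<open>y\<close>, up to a shear.  It is the middle term of an \<open>\<bbbE>\<close>-triangle
  \<open>A \<rightarrow> U \<rightarrow> Q\<close> with morphisms \<open>(-a, d)\<close> and \<open>(x, j)\<close>.  Composing the deflation \<open>U \<rightarrow> Q\<close> with \<open>c\<close>,
  (ET4op) gives \<open>N \<rightarrow> U \<rightarrow> E\<close>, whose deflation is \<open>(0, c j)\<close>, and a split \<open>\<bbbE>\<close>-triangle \<open>A \<rightarrow> N \<rightarrow> X\<close>.  It
  remains to cancel the summand \<open>X\<close> of \<open>N\<close> against that of \<open>U\<close>, which (ET4) does once \<open>X \<rightarrow> N\<close> is chosen
  such that \<open>X \<rightarrow> N \<rightarrow> U\<close> is the injection.
\<close>

lemma third_fibre:
  assumes tA: "etriangle C (A, a, X, z, Z, \<alpha>)" and tX: "etriangle C (X, x, Q, c, E, \<kappa>)"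
    and tK: "etriangle C (K, j, Q, y, Z, \<zeta>)" and yx: "y \<cdot> x = z"
  shows "\<exists>d \<tau>. etriangle C (A, d, K, c \<cdot> j, E, \<tau>) \<and> j \<cdot> d = x \<cdot> a \<and>
    push C Z d \<alpha> = \<zeta> \<and> push C E a \<tau> = \<kappa>"
proof -
  note dA = etriangleD[OF tA] and dX = etriangleD[OF tX] and dK = etriangleD[OF tK]
  have O: "A \<in> Obj C" "X \<in> Obj C" "Z \<in> Obj C" "Q \<in> Obj C" "E \<in> Obj C" "K \<in> Obj C"
    using dA(1,2) dX(1,2) dK(1) by simp_all
  note iX = ident_mor[OF O(2)] and iA = ident_mor[OF O(1)]
  obtain S j\<^sub>1 j\<^sub>2 q\<^sub>1 q\<^sub>2 where bS: "biproduct C X Q S j\<^sub>1 j\<^sub>2 q\<^sub>1 q\<^sub>2" using ex_biproduct O by blast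
  obtain U u\<^sub>X u\<^sub>K v\<^sub>X v\<^sub>K where bU: "biproduct C X K U u\<^sub>X u\<^sub>K v\<^sub>X v\<^sub>K" using ex_biproduct O by blast
  note S = biproductD[OF bS] and U = biproductD[OF bU]
  have SU: "S \<in> Obj C" "U \<in> Obj C" using S(1) U(1) by simp_all
  note ny = neg_closed[OF dK(2)]
  obtain P \<phi> \<pi> \<iota> where P: "etriangle C (A, \<phi>, P, \<pi>, Q, pull C A (neg_mor C Q Z y) \<alpha>)"
    "etriangle C (P, \<iota>, S, row_mor C S Z q\<^sub>1 q\<^sub>2 z y, Z, push C Z \<phi> \<alpha>)"
    "\<iota> \<cdot> \<phi> = j\<^sub>1 \<cdot> a" "q\<^sub>2 \<cdot> \<iota> = \<pi>"
    using homotopy_pullback[OF tA ny dK(2) add_neg(2)[OF dK(2)] bS] by blast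
  note p = etriangleD(1,2)[OF P(1)] and \<iota> = etriangleD(1)[OF P(2)]
  note nj = neg_closed[OF S(1)] and nq = neg_closed[OF S(3)]
  let ?J = "add_mor C X S (j\<^sub>2 \<cdot> x) (neg_mor C X S j\<^sub>1)"
  let ?Q = "add_mor C S Q q\<^sub>2 (neg_mor C S Q (x \<cdot> neg_mor C S X q\<^sub>1))"
  \<comment> \<open>in this decomposition of \<open>S\<close>, the morphism \<open>(z, y)\<close> is \<open>y\<close> after the projection to \<open>Q\<close>\<close>
  note bS' = biproduct_shear[OF biproduct_neg[OF biproduct_swap[OF bS]] dX(1)]
  note j2x = comp_closed[OF dX(1) S(2)] and j2j = comp_closed[OF dK(1) S(2)]
  note J = add_closed[OF j2x nj] and xnq = comp_closed[OF nq dX(1)]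
  note xq = comp_closed[OF S(3) dX(1)] and zq = comp_closed[OF S(3) dA(2)]
    and yq = comp_closed[OF S(4) dK(2)]
  have yxq: "y \<cdot> (x \<cdot> q\<^sub>1) = z \<cdot> q\<^sub>1" by (simp only: comp_assoc[OF S(3) dX(1) dK(2)] yx)
  have yQ: "y \<cdot> ?Q = row_mor C S Z q\<^sub>1 q\<^sub>2 z y"
    unfolding row_mor_def
    by (simp only: comp_neg_right[OF S(3) dX(1)] neg_neg[OF xq] comp_add_right[OF S(4) xq dK(2)]
        yxq add_comm_mor[OF yq zq])
  let ?T = "row_mor C U S v\<^sub>K v\<^sub>X (j\<^sub>2 \<cdot> j) ?J"
  have tU: "etriangle C (U, ?T, S, row_mor C S Z q\<^sub>1 q\<^sub>2 z y, Z, push C Z u\<^sub>K \<zeta>)"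
    using etriangle_add_left[OF tK biproduct_swap[OF bU] bS'] unfolding yQ .
  note T = row_comp[OF biproduct_swap[OF bU] j2j J]
  obtain \<theta> where \<theta>: "isomorphism C P U \<theta>" "?T \<cdot> \<theta> = \<iota>"
    "push C Z \<theta> (push C Z \<phi> \<alpha>) = push C Z u\<^sub>K \<zeta>"
    using same_deflation[OF P(2) tU] by blast
  have \<theta>a: "arrow C \<theta> P U" using \<theta>(1) by (simp add: isomorphism_def)
  let ?\<phi> = "\<theta> \<cdot> \<phi>" and ?\<pi> = "row_mor C U Q v\<^sub>K v\<^sub>X j x" and ?d = "v\<^sub>K \<cdot> (\<theta> \<cdot> \<phi>)"
  note \<phi> = comp_closed[OF p(1) \<theta>a] and \<pi> = row_comp[OF biproduct_swap[OF bU] dK(1) dX(1)]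
  note d = comp_closed[OF \<phi> U(4)]
  have q2J: "q\<^sub>2 \<cdot> ?J = x"
    by (simp only: comp_add_right[OF j2x nj S(4)] comp_assoc[OF dX(1) S(2,4)] S(6,7)
        comp_ident_left[OF dX(1)] comp_neg_right[OF S(1,4)] neg_zero[OF O(2,4)] add_zero[OF dX(1)])
  have q1J: "q\<^sub>1 \<cdot> ?J = neg_mor C X X (ident C X)"
    by (simp only: comp_add_right[OF j2x nj S(3)] comp_assoc[OF dX(1) S(2,3)] S(5,8)
        comp_zero_left[OF dX(1) O(2)] comp_neg_right[OF S(1,3)] add_zero[OF neg_closed[OF iX]])
  note q1T = comp_closed[OF T(1) S(3)] and q2T = comp_closed[OF T(1) S(4)]
  have \<pi>T: "?\<pi> = q\<^sub>2 \<cdot> ?T"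
    by (rule biproduct_coeqI[OF bU \<pi>(1) q2T])
      (simp_all only: \<pi>(2,3) comp_assoc[OF U(1) T(1) S(4), symmetric]
        comp_assoc[OF U(2) T(1) S(4), symmetric] T(2,3) q2J comp_assoc[OF dK(1) S(2,4)] S(6)
        comp_ident_left[OF dK(1)])
  have vT: "q\<^sub>1 \<cdot> ?T = neg_mor C U X v\<^sub>X"
    by (rule biproduct_coeqI[OF bU q1T neg_closed[OF U(3)]])
      (simp_all only: comp_assoc[OF U(1) T(1) S(3), symmetric]
        comp_assoc[OF U(2) T(1) S(3), symmetric] T(2,3) q1J comp_assoc[OF dK(1) S(2,3)] S(8)
        comp_zero_left[OF dK(1) O(2)] comp_neg_left[OF U(1,3)] comp_neg_left[OF U(2,3)] U(5,8)
        neg_zero[OF O(6,2)])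
  have T\<phi>: "?T \<cdot> ?\<phi> = j\<^sub>1 \<cdot> a" by (simp only: comp_assoc[OF p(1) \<theta>a T(1)] \<theta>(2) P(3))
  note v\<phi> = comp_closed[OF \<phi> U(3)]
  have "neg_mor C A X (v\<^sub>X \<cdot> ?\<phi>) = a"
    by (simp only: comp_neg_left[OF \<phi> U(3), symmetric] vT[symmetric] T\<phi>
        comp_assoc[OF \<phi> T(1) S(3), symmetric] comp_assoc[OF dA(1) S(1,3)] S(5) comp_ident_left[OF dA(1)])
  then have v\<^sub>X\<phi>: "v\<^sub>X \<cdot> ?\<phi> = neg_mor C A X a" using neg_neg[OF v\<phi>] by simp
  have "?\<pi> \<cdot> \<theta> = \<pi>" by (simp only: \<pi>T comp_assoc[OF \<theta>a T(1) S(4), symmetric] \<theta>(2) P(4))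
  from etriangle_change_middle[OF P(1) \<theta>(1) \<pi>(1) refl this]
  have tP: "etriangle C (A, ?\<phi>, U, ?\<pi>, Q, pull C A (neg_mor C Q Z y) \<alpha>)" .
  have jd: "j \<cdot> ?d = x \<cdot> a"
  proof (rule diff_zero_eq[OF comp_closed[OF d dK(1)] comp_closed[OF dA(1) dX(1)]])
    have "?\<phi> = column_mor C A U u\<^sub>K u\<^sub>X ?d (neg_mor C A X a)"
      using biproduct_decomp[OF biproduct_swap[OF bU] \<phi>] unfolding v\<^sub>X\<phi> .
    then have "?\<pi> \<cdot> ?\<phi> = add_mor C A Q (j \<cdot> ?d) (x \<cdot> neg_mor C A X a)"
      using row_column[OF biproduct_swap[OF bU] d neg_closed[OF dA(1)] dK(1) dX(1)] by simp
    then show "add_mor C A Q (j \<cdot> ?d) (neg_mor C A Q (x \<cdot> a)) = zero_mor C A Q"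
      by (simp only: comp_neg_right[OF dA(1) dX(1)] etriangle_comp_zero[OF tP])
  qed
  have d\<alpha>: "push C Z ?d \<alpha> = \<zeta>"
    by (simp only: push_comp[OF \<phi> U(4) dA(3)] push_comp[OF p(1) \<theta>a dA(3)] \<theta>(3)
        push_comp[OF U(2,4) dK(3), symmetric] U(6) push_ident[OF dK(3)])
  \<comment> \<open>the extension of \<open>A \<rightarrow> N \<rightarrow> X\<close> is a pullback of \<open>\<alpha>\<close> along \<open>-y x = -z\<close>, hence zero\<close>
  obtain f N g \<delta> n v \<chi> where N: "etriangle C (A, f, N, g, X, \<delta>)" "etriangle C (N, n, U, v, E, \<chi>)"
    "?\<phi> = n \<cdot> f" "x \<cdot> g = ?\<pi> \<cdot> n" "v = c \<cdot> ?\<pi>"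
    "pull C A x (pull C A (neg_mor C Q Z y) \<alpha>) = \<delta>" "push C E g \<chi> = \<kappa>"
    using ET4_op[OF tP tX] by metis
  note N1 = etriangleD[OF N(1)] and N2 = etriangleD[OF N(2)]
  have NO: "N \<in> Obj C" using N2(1) by simp
  note nid = neg_closed[OF iX]
  have \<delta>: "\<delta> = one (Ext C X A)"
  proof -
    have "neg_mor C Q Z y \<cdot> x = z \<cdot> neg_mor C X X (ident C X)"
      by (simp only: comp_neg_left[OF dX(1) dK(2)] comp_neg_right[OF iX dA(2)] yx
          comp_ident_right[OF dA(2)])
    then show ?thesis
      using N(6) pull_comp[OF ny dX(1) dA(3)] pull_comp[OF dA(2) nid dA(3)]
        pull_deflation[OF tA] pull_one[OF nid O(1)] by simp
  qed
  note tN = N(1)[unfolded \<delta>]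
  obtain s\<^sub>0 where s0: "arrow C s\<^sub>0 X N" "g \<cdot> s\<^sub>0 = ident C X"
    using lift_along_deflation[OF tN iX pull_one[OF iX O(1)]] by blast
  note ns0 = comp_closed[OF s0(1) N2(1)] and nu = neg_closed[OF U(1)]
  have "?\<pi> \<cdot> add_mor C X U (n \<cdot> s\<^sub>0) (neg_mor C X U u\<^sub>X) = zero_mor C X Q"
    by (simp only: comp_add_right[OF ns0 nu \<pi>(1)] comp_assoc[OF s0(1) N2(1) \<pi>(1)] N(4)[symmetric]
        comp_assoc[OF s0(1) N1(2) dX(1), symmetric] s0(2) comp_ident_right[OF dX(1)]
        comp_neg_right[OF U(1) \<pi>(1)] \<pi>(3) add_neg[OF dX(1)])
  then obtain t where t: "arrow C t X A" "?\<phi> \<cdot> t = add_mor C X U (n \<cdot> s\<^sub>0) (neg_mor C X U u\<^sub>X)"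
    using factor_through_inflation[OF tP add_closed[OF ns0 nu]] by blast
  note ft = comp_closed[OF t(1) N1(1)]
  \<comment> \<open>any section \<open>s\<^sub>0\<close> of \<open>g\<close> satisfies \<open>n s\<^sub>0 = u\<^sub>X + n f t\<close>; the correction \<open>f t\<close> does not affect \<open>g s\<^sub>0\<close>\<close>
  define s where "s = add_mor C X N s\<^sub>0 (neg_mor C X N (f \<cdot> t))"
  have s: "arrow C s X N" unfolding s_def by (rule add_closed[OF s0(1) neg_closed[OF ft]])
  have gs: "g \<cdot> s = ident C X"
    unfolding s_def
    by (simp only: comp_add_right[OF s0(1) neg_closed[OF ft] N1(2)] s0(2) comp_neg_right[OF ft N1(2)]
        comp_assoc[OF t(1) N1(1,2)] etriangle_comp_zero[OF tN] comp_zero_left[OF t(1) O(2)]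
        neg_zero[OF O(2,2)] add_zero[OF iX])
  have ns: "n \<cdot> s = u\<^sub>X"
  proof -
    interpret comm_group "Hom C X U" using hom_group O(2) SU(2) by blast
    have "n \<cdot> s = add_mor C X U (n \<cdot> s\<^sub>0)
        (neg_mor C X U (add_mor C X U (n \<cdot> s\<^sub>0) (neg_mor C X U u\<^sub>X)))"
      unfolding s_def
      by (simp only: comp_add_right[OF s0(1) neg_closed[OF ft] N2(1)] comp_neg_right[OF ft N2(1)]
          comp_assoc[OF t(1) N1(1) N2(1)] N(3)[symmetric] t(2))
    also have "\<dots> = u\<^sub>X"
      using ns0 U(1) by (simp add: inv_mult m_assoc[symmetric])
    finally show ?thesis .
  qed
  obtain r where bN: "biproduct C A X N f s r g" using zero_extension_splits[OF tN s gs] by blast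
  note R = biproductD[OF bN]
  obtain m h F \<theta>' w q \<eta> where F: "etriangle C (X, m, U, h, F, \<theta>')" "etriangle C (A, w, F, q, E, \<eta>)"
    "m = n \<cdot> s" "w \<cdot> r = h \<cdot> n" "v = q \<cdot> h" "push C E r \<chi> = \<eta>"
    using ET4[OF real_zero[OF biproduct_swap[OF bN]] N(2)] by metis
  note h = etriangleD(2)[OF F(1)] and F2 = etriangleD[OF F(2)]
  \<comment> \<open>both \<open>F\<close> and \<open>K\<close> are cones of the injection \<open>u\<^sub>X\<close>\<close>
  obtain k where k: "isomorphism C F K k" "k \<cdot> h = v\<^sub>K"
    using same_inflation[OF real_zero[OF bU]] F(1,3) ns by blast
  from k(1) obtain e where e: "arrow C k F K" "arrow C e K F" "e \<cdot> k = ident C F"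
    by (rule isomorphism_inverse)
  have he: "h = e \<cdot> v\<^sub>K"
    by (simp only: k(2)[symmetric] comp_assoc[OF h e(1,2)] e(3) comp_ident_left[OF h])
  have "k \<cdot> w = k \<cdot> (w \<cdot> r \<cdot> f)"
    by (simp only: comp_assoc[OF R(1,3) F2(1), symmetric] R(5) comp_ident_right[OF F2(1)])
  also have "\<dots> = ?d"
    by (simp only: F(4) comp_assoc[OF N1(1) N2(1) h, symmetric] N(3)[symmetric]
        comp_assoc[OF \<phi> h e(1)] k(2))
  finally have kw: "k \<cdot> w = ?d" .
  have hu: "h \<cdot> u\<^sub>K = e" by (simp only: he comp_assoc[OF U(2,4) e(2), symmetric] U(6) comp_ident_right[OF e(2)])
  have "q \<cdot> e = c \<cdot> j"
    by (simp only: hu[symmetric] comp_assoc[OF U(2) h F2(2)] F(5)[symmetric] N(5)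
        comp_assoc[OF U(2) \<pi>(1) dX(2), symmetric] \<pi>(2))
  then have "(c \<cdot> j) \<cdot> k = q"
    using comp_assoc[OF e(1,2) F2(2)] e(3) comp_ident_right[OF F2(2)] by simp
  from etriangle_change_middle[OF F(2) k(1) comp_closed[OF dK(1) dX(2)] kw this]
  have res: "etriangle C (A, ?d, K, c \<cdot> j, E, \<eta>)" .
  \<comment> \<open>as \<open>n\<^sub>* \<chi> = 0\<close>, this gives \<open>(a r)\<^sub>* \<chi> = g\<^sub>* \<chi>\<close>\<close>
  have vn: "v\<^sub>X \<cdot> n = add_mor C N X (neg_mor C N X (a \<cdot> r)) g"
  proof -
    have "v\<^sub>X \<cdot> n \<cdot> f = neg_mor C A X a"
      by (simp only: comp_assoc[OF N1(1) N2(1) U(3), symmetric] N(3)[symmetric] v\<^sub>X\<phi>)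
    moreover have "v\<^sub>X \<cdot> n \<cdot> s = ident C X"
      by (simp only: comp_assoc[OF s N2(1) U(3), symmetric] ns U(5))
    ultimately show ?thesis
      using biproduct_codecomp[OF bN comp_closed[OF N2(1) U(3)]] comp_neg_left[OF R(3) dA(1)]
        comp_ident_left[OF N1(2)] unfolding row_mor_def by simp
  qed
  have "push C E a \<eta> = \<kappa>"
  proof -
    interpret comm_group "Ext C E X" using ext_group O by blast
    note ar = comp_closed[OF R(3) dA(1)]
    have pa: "push C E a \<eta> = push C E (a \<cdot> r) \<chi>"
      using push_comp[OF R(3) dA(1) N2(3)] F(6) by simp
    have "one (Ext C E X) = push C E (v\<^sub>X \<cdot> n) \<chi>"
      using push_comp[OF N2(1) U(3) N2(3)] push_inflation[OF N(2)] push_one[OF U(3) O(5)] by simp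
    also have "\<dots> = inv\<^bsub>Ext C E X\<^esub> push C E a \<eta> \<otimes>\<^bsub>Ext C E X\<^esub> \<kappa>"
      by (simp only: vn push_add[OF neg_closed[OF ar] N1(2) N2(3)] push_neg[OF ar N2(3)] N(7) pa)
    finally show ?thesis
      using push_closed[OF dA(1) F2(3)] dX(3) by (metis inv_equality inv_inv inv_closed)
  qed
  then show ?thesis using res jd d\<alpha> by blast
qed

lemma third_cofibre:
  assumes "etriangle C (Z, z, X, a, A, \<alpha>)" and "etriangle C (E, c, Q, x, X, \<kappa>)"
    and "etriangle C (Z, y, Q, j, K, \<zeta>)" and "x \<cdot> y = z"
  shows "\<exists>d \<tau>. etriangle C (E, j \<cdot> c, K, d, A, \<tau>) \<and> d \<cdot> j = a \<cdot> x \<and>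
    pull C Z d \<alpha> = \<zeta> \<and> pull C E a \<tau> = \<kappa>"
proof -
  have "etriangle (opposite C) (A, a, X, z, Z, \<alpha>)" "etriangle (opposite C) (X, x, Q, c, E, \<kappa>)"
    "etriangle (opposite C) (K, j, Q, y, Z, \<zeta>)" "y \<cdot>\<^bsub>opposite C\<^esub> x = z"
    using assms by (simp_all only: etriangle_opposite opposite_simps)
  from extriangulated_category.third_fibre[OF op_ext this]
  show ?thesis unfolding etriangle_opposite opposite_simps .
qed

end

section \<open>Inflations under weak idempotent completeness\<close>

context extriangulated_category
begin

lemma weakly_idempotent_complete_opposite:
  "weakly_idempotent_complete (opposite C) \<longleftrightarrow> weakly_idempotent_complete C"
proof
  interpret op: extriangulated_category "opposite C" by (rule op_ext)
  show "weakly_idempotent_complete (opposite C)" if wic: "weakly_idempotent_complete C"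
  proof (rule op.weakly_idempotent_completeI)
    fix X Y s r assume "arrow (opposite C) s X Y" "arrow (opposite C) r Y X"
      "r \<cdot>\<^bsub>opposite C\<^esub> s = ident (opposite C) X"
    then have "arrow C r X Y" "arrow C s Y X" "s \<cdot> r = ident C X" by simp_all
    from weakly_idempotent_complete_biproduct[OF wic this]
    show "\<exists>V v r' w. biproduct (opposite C) X V Y s v r' w"
      unfolding biproduct_opposite by blast
  qed
  show "weakly_idempotent_complete C" if wic: "weakly_idempotent_complete (opposite C)"
  proof (rule weakly_idempotent_completeI)
    fix X Y s r assume "arrow C s X Y" "arrow C r Y X" "r \<cdot> s = ident C X"
    then have "arrow (opposite C) r X Y" "arrow (opposite C) s Y X"
      "s \<cdot>\<^bsub>opposite C\<^esub> r = ident (opposite C) X" by simp_all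
    from op.weakly_idempotent_complete_biproduct[OF wic this]
    show "\<exists>V v r' w. biproduct C X V Y s v r' w"
      unfolding biproduct_opposite by blast
  qed
qed

lemma inflation_comp:
  assumes "inflation C X Y f" "inflation C Y Z g"
  shows "inflation C X Z (g \<cdot> f)"
proof -
  obtain h W \<delta> where f: "etriangle C (X, f, Y, h, W, \<delta>)" using assms(1) unfolding inflation_def by blast
  obtain k V \<epsilon> where g: "etriangle C (Y, g, Z, k, V, \<epsilon>)" using assms(2) unfolding inflation_def by blast
  from ET4[OF f g] show ?thesis unfolding inflation_def by blast
qed

lemma ident_inflation:
  assumes "X \<in> Obj C"
  shows "inflation C X X (ident C X)"
  using etriangle_right_zero[OF _ assms] ex_zero_object unfolding inflation_def by blast

lemma inflation_change_codomain:
  assumes "inflation C X Y f" and b: "isomorphism C Y Y' b"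
  shows "inflation C X Y' (b \<cdot> f)"
proof -
  obtain g Z \<delta> where t: "etriangle C (X, f, Y, g, Z, \<delta>)" using assms(1) unfolding inflation_def by blast
  note g = etriangleD(2)[OF t]
  from b obtain a where a: "arrow C b Y Y'" "arrow C a Y' Y" "a \<cdot> b = ident C Y"
    by (rule isomorphism_inverse)
  have "g \<cdot> a \<cdot> b = g" using comp_assoc[OF a(1,2) g] a(3) comp_ident_right[OF g] by simp
  from etriangle_change_middle[OF t b comp_closed[OF a(2) g] refl this]
  show ?thesis unfolding inflation_def by blast
qed

text \<open>
  The projection to \<open>Z\<close> kills \<open>(i, 0)\<close> and so factors through the cone as \<open>u c\<close>, with \<open>u\<close> a retraction
  of \<open>c j\<^sub>2\<close>.  A complement turns \<open>u\<close> into a deflation, and the fibre of \<open>u c\<close> is \<open>Y\<close>; (ET4op) then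
  makes \<open>Y\<close> the middle term of an \<open>\<bbbE>\<close>-triangle that starts with \<open>i\<close>.
\<close>

lemma inflation_drop_zero:
  assumes wic: "weakly_idempotent_complete C" and i: "arrow C i X Y"
    and b: "biproduct C Y Z S j\<^sub>1 j\<^sub>2 q\<^sub>1 q\<^sub>2"
    and inf: "inflation C X S (column_mor C X S j\<^sub>1 j\<^sub>2 i (zero_mor C X Z))"
  shows "inflation C X Y i"
proof -
  note B = biproductD[OF b]
  have O: "X \<in> Obj C" "Z \<in> Obj C" using i B(2) by simp_all
  note ji = comp_closed[OF i B(1)]
  have col: "column_mor C X S j\<^sub>1 j\<^sub>2 i (zero_mor C X Z) = j\<^sub>1 \<cdot> i"
    unfolding column_mor_def by (simp only: comp_zero_right[OF B(2) O(1)] add_zero[OF ji])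
  obtain c W \<delta> where t: "etriangle C (X, j\<^sub>1 \<cdot> i, S, c, W, \<delta>)"
    using inf unfolding inflation_def col by blast
  note c = etriangleD(2)[OF t]
  have "q\<^sub>2 \<cdot> (j\<^sub>1 \<cdot> i) = zero_mor C X Z"
    by (simp only: comp_assoc[OF i B(1,4)] B(7) comp_zero_left[OF i O(2)])
  then obtain u where u: "arrow C u W Z" "u \<cdot> c = q\<^sub>2" using factor_through_deflation[OF t B(4)] by blast
  have "u \<cdot> (c \<cdot> j\<^sub>2) = ident C Z" by (simp only: comp_assoc[OF B(2) c u(1)] u(2) B(6))
  then obtain V v w where bW: "biproduct C Z V W (c \<cdot> j\<^sub>2) v u w"
    using weakly_idempotent_complete_biproduct[OF wic comp_closed[OF B(2) c] u(1)] by blast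
  obtain f N g \<delta>' n \<epsilon> where N: "etriangle C (X, f, N, g, V, \<delta>')" "etriangle C (N, n, S, q\<^sub>2, Z, \<epsilon>)"
    "j\<^sub>1 \<cdot> i = n \<cdot> f"
    using ET4_op[OF t real_zero[OF biproduct_swap[OF bW]]] unfolding u(2) by metis
  note f = etriangleD(1)[OF N(1)]
  obtain \<theta> where \<theta>: "isomorphism C N Y \<theta>" "j\<^sub>1 \<cdot> \<theta> = n"
    using same_deflation[OF N(2) real_zero[OF b]] by blast
  have \<theta>a: "arrow C \<theta> N Y" using \<theta>(1) by (simp add: isomorphism_def)
  note \<theta>f = comp_closed[OF f \<theta>a]
  have "\<theta> \<cdot> f = q\<^sub>1 \<cdot> (j\<^sub>1 \<cdot> (\<theta> \<cdot> f))"
    by (simp only: comp_assoc[OF \<theta>f B(1,3)] B(5) comp_ident_left[OF \<theta>f])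
  also have "\<dots> = q\<^sub>1 \<cdot> (j\<^sub>1 \<cdot> i)" by (simp only: comp_assoc[OF f \<theta>a B(1)] \<theta>(2) N(3))
  also have "\<dots> = i" by (simp only: comp_assoc[OF i B(1,3)] B(5) comp_ident_left[OF i])
  finally have "\<theta> \<cdot> f = i" .
  moreover have "inflation C X N f" using N(1) unfolding inflation_def by blast
  ultimately show ?thesis using inflation_change_codomain[OF _ \<theta>(1)] by metis
qed

text \<open>
  With \<open>g f\<close> also \<open>(g f, f) : X \<rightarrow> Z \<oplus> Y\<close> is an inflation.  It is \<open>(f, 0)\<close> for the decomposition of the
  sum in which \<open>Y\<close> is embedded as the graph of \<open>g\<close>.
\<close>

lemma inflation_left_cancel:
  assumes drop: "\<And>X Y Z i S j\<^sub>1 j\<^sub>2 q\<^sub>1 q\<^sub>2. \<lbrakk>arrow C i X Y; biproduct C Y Z S j\<^sub>1 j\<^sub>2 q\<^sub>1 q\<^sub>2;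
      inflation C X S (column_mor C X S j\<^sub>1 j\<^sub>2 i (zero_mor C X Z))\<rbrakk> \<Longrightarrow> inflation C X Y i"
    and f: "arrow C f X Y" and g: "arrow C g Y Z" and gf: "inflation C X Z (g \<cdot> f)"
  shows "inflation C X Y f"
proof -
  have O: "X \<in> Obj C" "Y \<in> Obj C" "Z \<in> Obj C" using f g by simp_all
  obtain S j\<^sub>1 j\<^sub>2 q\<^sub>1 q\<^sub>2 where b: "biproduct C Z Y S j\<^sub>1 j\<^sub>2 q\<^sub>1 q\<^sub>2" using ex_biproduct O by blast
  note B = biproductD[OF b]
  obtain h W \<delta> where t: "etriangle C (X, g \<cdot> f, Z, h, W, \<delta>)"
    using gf unfolding inflation_def by blast
  have "inflation C X S (column_mor C X S j\<^sub>1 j\<^sub>2 (g \<cdot> f) f)"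
    using homotopy_pushout[OF t neg_closed[OF f] f add_neg(2)[OF f] b] unfolding inflation_def by blast
  moreover have "column_mor C X S j\<^sub>1 j\<^sub>2 (g \<cdot> f) f =
      column_mor C X S (add_mor C Y S (j\<^sub>1 \<cdot> g) j\<^sub>2) j\<^sub>1 f (zero_mor C X Z)"
    unfolding column_mor_def
    by (simp only: comp_add_left[OF f comp_closed[OF g B(1)] B(2)] comp_assoc[OF f g B(1)]
        comp_zero_right[OF B(1) O(1)]
        add_zero[OF add_closed[OF comp_closed[OF f comp_closed[OF g B(1)]] comp_closed[OF f B(2)]]])
  ultimately show ?thesis using drop[OF f biproduct_swap[OF biproduct_shear[OF b g]]] by simp
qed

text \<open>
  If \<open>r s = 1\<close>, the extension of \<open>s\<close> is \<open>\<delta> = r\<^sub>* s\<^sub>* \<delta> = 0\<close>.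
\<close>

lemma wic_if_sections_inflations:
  assumes "\<And>X Y s r. \<lbrakk>arrow C s X Y; arrow C r Y X; r \<cdot> s = ident C X\<rbrakk> \<Longrightarrow> inflation C X Y s"
  shows "weakly_idempotent_complete C"
proof (rule weakly_idempotent_completeI)
  fix X Y s r assume s: "arrow C s X Y" and r: "arrow C r Y X" and rs: "r \<cdot> s = ident C X"
  obtain g Z \<delta> where t: "etriangle C (X, s, Y, g, Z, \<delta>)"
    using assms[OF s r rs] unfolding inflation_def by blast
  note a = etriangleD[OF t]
  have O: "X \<in> Obj C" "Z \<in> Obj C" using a by simp_all
  have "push C Z r (push C Z s \<delta>) = \<delta>"
    using push_comp[OF s r a(3)] rs push_ident[OF a(3)] by simp
  then have \<delta>: "\<delta> = one (Ext C Z X)" using push_inflation[OF t] push_one[OF r O(2)] by simp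
  note iZ = ident_mor[OF O(2)]
  obtain k where "arrow C k Z Y" "g \<cdot> k = ident C Z"
    using lift_along_deflation[OF t[unfolded \<delta>] iZ pull_one[OF iZ O(1)]] by blast
  then show "\<exists>V v r' w. biproduct C X V Y s v r' w"
    using zero_extension_splits[OF t[unfolded \<delta>]] by blast
qed

lemma wic_iff_inflation_left_cancel:
  "weakly_idempotent_complete C \<longleftrightarrow>
    (\<forall>X Y Z f g. arrow C f X Y \<and> arrow C g Y Z \<and> inflation C X Z (g \<cdot> f) \<longrightarrow> inflation C X Y f)"
    (is "_ \<longleftrightarrow> ?R")
proof
  show ?R if wic: "weakly_idempotent_complete C"
  proof (intro allI impI, elim conjE)
    fix X Y Z f g
    assume "X \<in> Obj C" "Y \<in> Obj C" "Z \<in> Obj C" "f \<in> carrier (Hom C X Y)" "g \<in> carrier (Hom C Y Z)"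
      and gf: "inflation C X Z (g \<cdot> f)"
    then have fg: "arrow C f X Y" "arrow C g Y Z" by simp_all
    show "inflation C X Y f"
      by (rule inflation_left_cancel[OF _ fg gf]) (rule inflation_drop_zero[OF wic])
  qed
  show "weakly_idempotent_complete C" if R: ?R
  proof (rule wic_if_sections_inflations)
    fix X Y s r assume s: "arrow C s X Y" "arrow C r Y X" "r \<cdot> s = ident C X"
    then have "inflation C X X (r \<cdot> s)" using ident_inflation by simp
    then show "inflation C X Y s" using R s by blast
  qed
qed

lemma wic_iff_inflation_drop_zero:
  "weakly_idempotent_complete C \<longleftrightarrow>
    (\<forall>X Y Z i S j\<^sub>1 j\<^sub>2 q\<^sub>1 q\<^sub>2. arrow C i X Y \<and> biproduct C Y Z S j\<^sub>1 j\<^sub>2 q\<^sub>1 q\<^sub>2 \<and>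
        inflation C X S (column_mor C X S j\<^sub>1 j\<^sub>2 i (zero_mor C X Z)) \<longrightarrow> inflation C X Y i)"
    (is "_ \<longleftrightarrow> ?R")
proof
  show ?R if "weakly_idempotent_complete C" using inflation_drop_zero[OF that] by blast
  assume R: ?R
  show "weakly_idempotent_complete C"
    unfolding wic_iff_inflation_left_cancel
  proof (intro allI impI, elim conjE)
    fix X Y Z f g
    assume "X \<in> Obj C" "Y \<in> Obj C" "Z \<in> Obj C" "f \<in> carrier (Hom C X Y)" "g \<in> carrier (Hom C Y Z)"
      and gf: "inflation C X Z (g \<cdot> f)"
    then have fg: "arrow C f X Y" "arrow C g Y Z" by simp_all
    show "inflation C X Y f" by (rule inflation_left_cancel[OF _ fg gf]) (use R in blast)
  qed
qed

text \<open>
  If \<open>f'\<close> is a retract of an inflation \<open>f\<close> through \<open>i\<close> and \<open>j\<close>, then \<open>i\<close> is a section, hence an inflation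
  by cancellation; so is \<open>f i = j f'\<close>, and therefore \<open>f'\<close>.
\<close>

lemma wic_iff_inflation_retract:
  "weakly_idempotent_complete C \<longleftrightarrow>
    (\<forall>A B f A' B' f'. inflation C A B f \<and> retract C A' B' f' A B f \<longrightarrow> inflation C A' B' f')"
    (is "_ \<longleftrightarrow> ?R")
proof
  assume wic: "weakly_idempotent_complete C"
  note cancel = wic[unfolded wic_iff_inflation_left_cancel, rule_format]
  show ?R
  proof (intro allI impI, elim conjE)
    fix A B f A' B' f' assume f: "inflation C A B f" and "retract C A' B' f' A B f"
    then obtain i p j q where a: "arrow C f' A' B'" "arrow C i A' A" "arrow C p A A'" "arrow C j B' B"
      "f \<cdot> i = j \<cdot> f'" "p \<cdot> i = ident C A'"
      unfolding retract_def by blast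
    have "inflation C A' A' (p \<cdot> i)" using ident_inflation a(1,6) by simp
    then have "inflation C A' A i" using cancel a(2,3) by blast
    then have "inflation C A' B (j \<cdot> f')" using inflation_comp[OF _ f] a(5) by metis
    then show "inflation C A' B' f'" using cancel a(1,4) by blast
  qed
next
  assume R: ?R
  show "weakly_idempotent_complete C"
    unfolding wic_iff_inflation_drop_zero
  proof (intro allI impI, elim conjE)
    fix X Y Z i S j\<^sub>1 j\<^sub>2 q\<^sub>1 q\<^sub>2
    assume "X \<in> Obj C" "Y \<in> Obj C" "i \<in> carrier (Hom C X Y)"
      and b: "biproduct C Y Z S j\<^sub>1 j\<^sub>2 q\<^sub>1 q\<^sub>2"
      and inf: "inflation C X S (column_mor C X S j\<^sub>1 j\<^sub>2 i (zero_mor C X Z))"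
    then have i: "arrow C i X Y" by simp
    note B = biproductD[OF b]
    have O: "X \<in> Obj C" "Z \<in> Obj C" using i B(2) by simp_all
    note c = column_comp[OF b i zero_closed[OF O]] and iX = ident_mor[OF O(1)]
    have col: "column_mor C X S j\<^sub>1 j\<^sub>2 i (zero_mor C X Z) = j\<^sub>1 \<cdot> i"
      unfolding column_mor_def
      by (simp only: comp_zero_right[OF B(2) O(1)] add_zero[OF comp_closed[OF i B(1)]])
    have e: "column_mor C X S j\<^sub>1 j\<^sub>2 i (zero_mor C X Z) \<cdot> ident C X = j\<^sub>1 \<cdot> i"
      "i \<cdot> ident C X = q\<^sub>1 \<cdot> column_mor C X S j\<^sub>1 j\<^sub>2 i (zero_mor C X Z)"
      by (simp_all only: comp_ident_right[OF c(1)] col[symmetric] comp_ident_right[OF i] c(2))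
    have "retract C X Y i X S (column_mor C X S j\<^sub>1 j\<^sub>2 i (zero_mor C X Z))"
      unfolding retract_def using i c(1) iX B(1,3,5) e comp_ident_left[OF iX] by blast
    then show "inflation C X Y i" using R inf by blast
  qed
qed

end

section \<open>The three-by-three lemma\<close>

context extriangulated_category
begin

text \<open>
  Weak idempotent completeness enters through \<open>cancel\<close> only, which makes \<open>A\<^sub>2 \<rightarrow> Q\<close> an inflation.
  The relations between the extensions of the new column and row and the given ones are those of
  \<open>third_fibre\<close> and \<open>third_cofibre\<close>, combined with the values of the extensions of the homotopy pullback
  \<open>Q\<close> and the homotopy pushout \<open>F\<close>.
\<close>

lemma three_by_three_lemma:
  assumes cancel: "\<And>X Y Z f g. \<lbrakk>arrow C f X Y; arrow C g Y Z; inflation C X Z (g \<cdot> f)\<rbrakk>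
      \<Longrightarrow> inflation C X Y f"
    and tA: "etriangle C (A\<^sub>1, f\<^sub>A, A\<^sub>2, g\<^sub>A, A\<^sub>3, \<delta>\<^sub>A)" and tB: "etriangle C (B\<^sub>1, f\<^sub>B, B\<^sub>2, g\<^sub>B, B\<^sub>3, \<delta>\<^sub>B)"
    and t2: "etriangle C (A\<^sub>2, i\<^sub>2, B\<^sub>2, p\<^sub>2, C\<^sub>2, \<epsilon>\<^sub>2)" and t3: "etriangle C (A\<^sub>3, i\<^sub>3, B\<^sub>3, p\<^sub>3, C\<^sub>3, \<epsilon>\<^sub>3)"
    and sq: "g\<^sub>B \<cdot> i\<^sub>2 = i\<^sub>3 \<cdot> g\<^sub>A"
  shows "\<exists>i\<^sub>1 p\<^sub>1 C\<^sub>1 \<epsilon>\<^sub>1 f\<^sub>C g\<^sub>C \<delta>\<^sub>C.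
    three_by_three C (A\<^sub>1, f\<^sub>A, A\<^sub>2, g\<^sub>A, A\<^sub>3, \<delta>\<^sub>A) (B\<^sub>1, f\<^sub>B, B\<^sub>2, g\<^sub>B, B\<^sub>3, \<delta>\<^sub>B)
      (C\<^sub>1, f\<^sub>C, C\<^sub>2, g\<^sub>C, C\<^sub>3, \<delta>\<^sub>C) (i\<^sub>1, p\<^sub>1, \<epsilon>\<^sub>1) (i\<^sub>2, p\<^sub>2, \<epsilon>\<^sub>2) (i\<^sub>3, p\<^sub>3, \<epsilon>\<^sub>3)"
proof -
  note A = etriangleD[OF tA] and B = etriangleD[OF tB] and c2 = etriangleD[OF t2]
    and c3 = etriangleD[OF t3]
  have O: "A\<^sub>3 \<in> Obj C" "B\<^sub>2 \<in> Obj C" "B\<^sub>3 \<in> Obj C" using A(2) B(2) by simp_all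
  obtain S j\<^sub>1 j\<^sub>2 q\<^sub>1 q\<^sub>2 where b: "biproduct C B\<^sub>2 A\<^sub>3 S j\<^sub>1 j\<^sub>2 q\<^sub>1 q\<^sub>2" using ex_biproduct O by blast
  note S = biproductD[OF b]
  note ni = neg_closed[OF c3(1)] and ng = neg_closed[OF A(2)] and nj = neg_closed[OF S(2)]
  \<comment> \<open>with \<open>L = (i\<^sub>2, g\<^sub>A)\<close>, one sign is needed to achieve \<open>R L = 0\<close>\<close>
  let ?R = "row_mor C S B\<^sub>3 q\<^sub>1 q\<^sub>2 g\<^sub>B (neg_mor C A\<^sub>3 B\<^sub>3 i\<^sub>3)"
  let ?L = "column_mor C A\<^sub>2 S j\<^sub>1 j\<^sub>2 i\<^sub>2 g\<^sub>A"
  note R = row_comp[OF b B(2) ni] and L = column_comp[OF b c2(1) A(2)]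
  obtain Q \<phi> \<pi> \<iota> where Q: "etriangle C (B\<^sub>1, \<phi>, Q, \<pi>, A\<^sub>3, pull C B\<^sub>1 i\<^sub>3 \<delta>\<^sub>B)"
    "etriangle C (Q, \<iota>, S, ?R, B\<^sub>3, push C B\<^sub>3 \<phi> \<delta>\<^sub>B)" "\<iota> \<cdot> \<phi> = j\<^sub>1 \<cdot> f\<^sub>B" "q\<^sub>2 \<cdot> \<iota> = \<pi>"
    using homotopy_pullback[OF tB c3(1) ni add_neg(1)[OF c3(1)] b] by blast
  note \<phi> = etriangleD(1)[OF Q(1)] and \<iota> = etriangleD(1)[OF Q(2)]
  have L': "column_mor C A\<^sub>2 S j\<^sub>1 (neg_mor C A\<^sub>3 S j\<^sub>2) i\<^sub>2 (neg_mor C A\<^sub>2 A\<^sub>3 g\<^sub>A) = ?L"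
    unfolding column_mor_def
    by (simp only: comp_neg_left[OF ng S(2)] comp_neg_right[OF A(2) S(2)] neg_neg[OF comp_closed[OF A(2) S(2)]])
  \<comment> \<open>negating the summand \<open>A\<^sub>3\<close> removes the sign from the extension of \<open>F\<close>\<close>
  obtain F \<rho> \<sigma> H where F: "etriangle C (A\<^sub>3, \<sigma>, F, \<rho>, C\<^sub>2, push C C\<^sub>2 g\<^sub>A \<epsilon>\<^sub>2)"
    "etriangle C (A\<^sub>2, ?L, S, H, F, pull C A\<^sub>2 \<rho> \<epsilon>\<^sub>2)" "\<rho> \<cdot> H = p\<^sub>2 \<cdot> q\<^sub>1" "H \<cdot> neg_mor C A\<^sub>3 S j\<^sub>2 = \<sigma>"
    using homotopy_pushout[OF t2 A(2) ng add_neg(1)[OF A(2)] biproduct_neg[OF b]] unfolding L' by blast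
  note \<rho> = etriangleD(2)[OF F(1)] and H = etriangleD(2)[OF F(2)]
  have "?R \<cdot> ?L = zero_mor C A\<^sub>2 B\<^sub>3"
    by (simp only: row_column[OF b c2(1) A(2) B(2) ni] comp_neg_left[OF A(2) c3(1)] sq
        add_neg[OF comp_closed[OF A(2) c3(1)]])
  then obtain k where k: "arrow C k A\<^sub>2 Q" "\<iota> \<cdot> k = ?L"
    using factor_through_inflation[OF Q(2) L(1)] by blast
  have "inflation C A\<^sub>2 S (\<iota> \<cdot> k)" using F(2) k(2) unfolding inflation_def by metis
  then obtain c C\<^sub>1 \<kappa> where tk: "etriangle C (A\<^sub>2, k, Q, c, C\<^sub>1, \<kappa>)"
    using cancel[OF k(1) \<iota>] unfolding inflation_def by blast
  note c = etriangleD(2)[OF tk]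
  have "\<pi> \<cdot> k = g\<^sub>A" by (simp only: Q(4)[symmetric] comp_assoc[OF k(1) \<iota> S(4), symmetric] k(2) L(3))
  from third_fibre[OF tA tk Q(1) this] obtain i\<^sub>1 \<epsilon>\<^sub>1 where
    t1: "etriangle C (A\<^sub>1, i\<^sub>1, B\<^sub>1, c \<cdot> \<phi>, C\<^sub>1, \<epsilon>\<^sub>1)" and i1: "\<phi> \<cdot> i\<^sub>1 = k \<cdot> f\<^sub>A"
    "push C A\<^sub>3 i\<^sub>1 \<delta>\<^sub>A = pull C B\<^sub>1 i\<^sub>3 \<delta>\<^sub>B" "push C C\<^sub>1 f\<^sub>A \<epsilon>\<^sub>1 = \<kappa>"
    by blast
  note c1 = etriangleD[OF t1]
  obtain H' F' \<theta> \<nu>' \<mu>' \<eta> where F': "etriangle C (A\<^sub>2, ?L, S, H', F', \<theta>)"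
    "etriangle C (C\<^sub>1, \<nu>', F', \<mu>', B\<^sub>3, \<eta>)" "\<nu>' \<cdot> c = H' \<cdot> \<iota>" "?R = \<mu>' \<cdot> H'"
    "pull C A\<^sub>2 \<nu>' \<theta> = \<kappa>" "push C B\<^sub>3 c (push C B\<^sub>3 \<phi> \<delta>\<^sub>B) = \<eta>"
    using ET4[OF tk Q(2)] unfolding k(2) by metis
  note H' = etriangleD(2)[OF F'(1)] and F'a = etriangleD[OF F'(2)]
  \<comment> \<open>(ET4) provides its own cone \<open>F'\<close> of \<open>L\<close>, to be identified with \<open>F\<close>\<close>
  obtain w where w: "isomorphism C F' F w" "w \<cdot> H' = H" "pull C A\<^sub>2 w (pull C A\<^sub>2 \<rho> \<epsilon>\<^sub>2) = \<theta>"
    using same_inflation[OF F(2) F'(1)] by blast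
  from w(1) obtain w' where w': "arrow C w F' F" "arrow C w' F F'" "w' \<cdot> w = ident C F'"
    by (rule isomorphism_inverse)
  let ?\<nu> = "w \<cdot> \<nu>'" and ?\<mu> = "\<mu>' \<cdot> w'"
  note \<nu> = comp_closed[OF F'a(1) w'(1)] and \<mu> = comp_closed[OF w'(2) F'a(2)]
  have "?\<mu> \<cdot> w = \<mu>'"
    by (simp only: comp_assoc[OF w'(1,2) F'a(2), symmetric] w'(3) comp_ident_right[OF F'a(2)])
  from etriangle_change_middle[OF F'(2) w(1) \<mu> refl this]
  have tF: "etriangle C (C\<^sub>1, ?\<nu>, F, ?\<mu>, B\<^sub>3, \<eta>)" .
  have \<mu>H: "?\<mu> \<cdot> H = ?R"
    by (simp only: w(2)[symmetric] comp_assoc[OF H' w'(1) \<mu>] \<open>?\<mu> \<cdot> w = \<mu>'\<close> F'(4))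
  have \<nu>c: "?\<nu> \<cdot> c = H \<cdot> \<iota>"
    by (simp only: comp_assoc[OF c F'a(1) w'(1), symmetric] F'(3) comp_assoc[OF \<iota> H' w'(1)] w(2))
  have "?\<mu> \<cdot> \<sigma> = i\<^sub>3"
    by (simp only: F(4)[symmetric] comp_assoc[OF nj H \<mu>] \<mu>H comp_neg_right[OF S(2) R(1)] R(3)
        neg_neg[OF c3(1)])
  from third_cofibre[OF t3 tF F(1) this] obtain g\<^sub>C \<delta>\<^sub>C where
    tC: "etriangle C (C\<^sub>1, \<rho> \<cdot> ?\<nu>, C\<^sub>2, g\<^sub>C, C\<^sub>3, \<delta>\<^sub>C)" and gC: "g\<^sub>C \<cdot> \<rho> = p\<^sub>3 \<cdot> ?\<mu>"
    "pull C A\<^sub>3 g\<^sub>C \<epsilon>\<^sub>3 = push C C\<^sub>2 g\<^sub>A \<epsilon>\<^sub>2" "pull C C\<^sub>1 p\<^sub>3 \<delta>\<^sub>C = \<eta>"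
    by blast
  note Ca = etriangleD[OF tC]
  have q\<iota>\<phi>: "q\<^sub>1 \<cdot> (\<iota> \<cdot> \<phi>) = f\<^sub>B"
    by (simp only: Q(3) comp_assoc[OF B(1) S(1,3)] S(5) comp_ident_left[OF B(1)])
  have "f\<^sub>B \<cdot> i\<^sub>1 = q\<^sub>1 \<cdot> (\<iota> \<cdot> (\<phi> \<cdot> i\<^sub>1))"
    by (simp only: q\<iota>\<phi>[symmetric] comp_assoc[OF c1(1) comp_closed[OF \<phi> \<iota>] S(3), symmetric]
        comp_assoc[OF c1(1) \<phi> \<iota>])
  also have "\<dots> = i\<^sub>2 \<cdot> f\<^sub>A"
    by (simp only: i1(1) comp_assoc[OF A(1) k(1) \<iota>] k(2) comp_assoc[OF A(1) L(1) S(3)] L(2))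
  finally have e1: "f\<^sub>B \<cdot> i\<^sub>1 = i\<^sub>2 \<cdot> f\<^sub>A" .
  note p2q = comp_closed[OF S(3) c2(2)]
  have "(\<rho> \<cdot> ?\<nu>) \<cdot> (c \<cdot> \<phi>) = \<rho> \<cdot> (H \<cdot> (\<iota> \<cdot> \<phi>))"
    by (simp only: comp_assoc[OF c1(2) \<nu> \<rho>, symmetric] comp_assoc[OF \<phi> c \<nu>] \<nu>c
        comp_assoc[OF \<phi> \<iota> H])
  also have "\<dots> = p\<^sub>2 \<cdot> f\<^sub>B"
    by (simp only: comp_assoc[OF comp_closed[OF \<phi> \<iota>] H \<rho>] F(3)
        comp_assoc[OF comp_closed[OF \<phi> \<iota>] S(3) c2(2), symmetric] q\<iota>\<phi>)
  finally have e2: "p\<^sub>2 \<cdot> f\<^sub>B = (\<rho> \<cdot> ?\<nu>) \<cdot> (c \<cdot> \<phi>)" by simp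
  have "g\<^sub>C \<cdot> p\<^sub>2 = g\<^sub>C \<cdot> ((p\<^sub>2 \<cdot> q\<^sub>1) \<cdot> j\<^sub>1)"
    by (simp only: comp_assoc[OF S(1,3) c2(2), symmetric] S(5) comp_ident_right[OF c2(2)])
  also have "\<dots> = p\<^sub>3 \<cdot> (?R \<cdot> j\<^sub>1)"
    by (simp only: F(3)[symmetric] comp_assoc[OF S(1) comp_closed[OF H \<rho>] Ca(2)] comp_assoc[OF H \<rho> Ca(2)]
        gC(1) comp_assoc[OF H \<mu> c3(2), symmetric] \<mu>H comp_assoc[OF S(1) R(1) c3(2), symmetric])
  finally have e3: "g\<^sub>C \<cdot> p\<^sub>2 = p\<^sub>3 \<cdot> g\<^sub>B" by (simp only: R(2))
  have x1: "push C B\<^sub>3 (c \<cdot> \<phi>) \<delta>\<^sub>B = pull C C\<^sub>1 p\<^sub>3 \<delta>\<^sub>C"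
    by (simp only: push_comp[OF \<phi> c B(3)] F'(6) gC(3))
  have x2: "push C C\<^sub>1 f\<^sub>A \<epsilon>\<^sub>1 = pull C A\<^sub>2 (\<rho> \<cdot> ?\<nu>) \<epsilon>\<^sub>2"
    by (simp only: i1(3) F'(5)[symmetric] w(3)[symmetric] pull_comp[OF \<rho> \<nu> c2(3)]
        pull_comp[OF w'(1) F'a(1) pull_closed[OF \<rho> c2(3)]])
  have "three_by_three C (A\<^sub>1, f\<^sub>A, A\<^sub>2, g\<^sub>A, A\<^sub>3, \<delta>\<^sub>A) (B\<^sub>1, f\<^sub>B, B\<^sub>2, g\<^sub>B, B\<^sub>3, \<delta>\<^sub>B)
      (C\<^sub>1, \<rho> \<cdot> ?\<nu>, C\<^sub>2, g\<^sub>C, C\<^sub>3, \<delta>\<^sub>C) (i\<^sub>1, c \<cdot> \<phi>, \<epsilon>\<^sub>1) (i\<^sub>2, p\<^sub>2, \<epsilon>\<^sub>2) (i\<^sub>3, p\<^sub>3, \<epsilon>\<^sub>3)"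
    unfolding three_by_three.simps Let_def etriangle_mor.simps
    using tA tB tC t1 t2 t3 A B Ca c1 c2 c3 e1 e2 e3 sq x1 x2 i1(2) gC(2) by metis
  then show ?thesis by blast
qed

text \<open>
  In \<open>S = X \<oplus> Y\<close> let \<open>Y\<close> be embedded as the graph of \<open>r\<close> and \<open>X\<close> as the graph of \<open>s\<close>.  As \<open>r s = 1\<close>, the
  second embedding is the first one composed with \<open>s\<close>.  Take the rows \<open>X = X \<rightarrow> 0\<close> and \<open>Y \<rightarrow> S \<rightarrow> X\<close>
  and the columns \<open>X \<rightarrow> S \<rightarrow> Y\<close> and \<open>0 \<rightarrow> X = X\<close>: the morphism \<open>X \<rightarrow> Y\<close> of the resulting first column
  can only be \<open>s\<close>.
\<close>

lemma section_inflation_if_three_by_three: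
  assumes tbt: "\<And>A\<^sub>1 f\<^sub>A A\<^sub>2 g\<^sub>A A\<^sub>3 \<delta>\<^sub>A B\<^sub>1 f\<^sub>B B\<^sub>2 g\<^sub>B B\<^sub>3 \<delta>\<^sub>B i\<^sub>2 p\<^sub>2 C\<^sub>2 \<epsilon>\<^sub>2 i\<^sub>3 p\<^sub>3 C\<^sub>3 \<epsilon>\<^sub>3.
      \<lbrakk>etriangle C (A\<^sub>1, f\<^sub>A, A\<^sub>2, g\<^sub>A, A\<^sub>3, \<delta>\<^sub>A); etriangle C (B\<^sub>1, f\<^sub>B, B\<^sub>2, g\<^sub>B, B\<^sub>3, \<delta>\<^sub>B);
        etriangle C (A\<^sub>2, i\<^sub>2, B\<^sub>2, p\<^sub>2, C\<^sub>2, \<epsilon>\<^sub>2); etriangle C (A\<^sub>3, i\<^sub>3, B\<^sub>3, p\<^sub>3, C\<^sub>3, \<epsilon>\<^sub>3);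
        g\<^sub>B \<cdot> i\<^sub>2 = i\<^sub>3 \<cdot> g\<^sub>A\<rbrakk>
      \<Longrightarrow> \<exists>i\<^sub>1 p\<^sub>1 C\<^sub>1 \<epsilon>\<^sub>1 f\<^sub>C g\<^sub>C \<delta>\<^sub>C.
        three_by_three C (A\<^sub>1, f\<^sub>A, A\<^sub>2, g\<^sub>A, A\<^sub>3, \<delta>\<^sub>A) (B\<^sub>1, f\<^sub>B, B\<^sub>2, g\<^sub>B, B\<^sub>3, \<delta>\<^sub>B)
          (C\<^sub>1, f\<^sub>C, C\<^sub>2, g\<^sub>C, C\<^sub>3, \<delta>\<^sub>C) (i\<^sub>1, p\<^sub>1, \<epsilon>\<^sub>1) (i\<^sub>2, p\<^sub>2, \<epsilon>\<^sub>2) (i\<^sub>3, p\<^sub>3, \<epsilon>\<^sub>3)"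
    and s: "arrow C s X Y" and r: "arrow C r Y X" and rs: "r \<cdot> s = ident C X"
  shows "inflation C X Y s"
proof -
  obtain N where N: "zero_object C N" using ex_zero_object by blast
  have O: "X \<in> Obj C" "Y \<in> Obj C" "N \<in> Obj C" using s N by (simp_all add: zero_object_def)
  obtain S j\<^sub>1 j\<^sub>2 q\<^sub>1 q\<^sub>2 where b: "biproduct C X Y S j\<^sub>1 j\<^sub>2 q\<^sub>1 q\<^sub>2" using ex_biproduct O by blast
  note B = biproductD[OF b]
  note bB = biproduct_shear[OF b r] and bC = biproduct_shear[OF biproduct_swap[OF b] s]
  let ?J = "add_mor C Y S (j\<^sub>1 \<cdot> r) j\<^sub>2" and ?I = "add_mor C X S (j\<^sub>2 \<cdot> s) j\<^sub>1"
  let ?P = "add_mor C S X q\<^sub>1 (neg_mor C S X (r \<cdot> q\<^sub>2))"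
  note B' = biproductD[OF bB] and C' = biproductD[OF bC]
  have Js: "?J \<cdot> s = ?I"
    by (simp only: comp_add_left[OF s comp_closed[OF r B(1)] B(2)] comp_assoc[OF s r B(1), symmetric] rs
        comp_ident_right[OF B(1)] add_comm_mor[OF B(1) comp_closed[OF s B(2)]])
  have "?P \<cdot> ?I = zero_mor C N X \<cdot> zero_mor C X N"
    by (simp only: Js[symmetric] comp_assoc[OF s B'(2,3)] B'(8) comp_zero_left[OF s O(1)]
        comp_zero_left[OF zero_closed[OF O(1,3)] O(1)])
  from tbt[OF etriangle_right_zero[OF N O(1)] real_zero[OF biproduct_swap[OF bB]]
      real_zero[OF biproduct_swap[OF bC]] etriangle_left_zero[OF N O(1)] this]
  obtain i\<^sub>1 p\<^sub>1 C\<^sub>1 \<epsilon>\<^sub>1 where i1: "etriangle C (X, i\<^sub>1, Y, p\<^sub>1, C\<^sub>1, \<epsilon>\<^sub>1)" "?J \<cdot> i\<^sub>1 = ?I \<cdot> ident C X"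
    unfolding three_by_three.simps Let_def etriangle_mor.simps by metis
  note i1a = etriangleD(1)[OF i1(1)]
  have "i\<^sub>1 = q\<^sub>2 \<cdot> (?J \<cdot> i\<^sub>1)" by (simp only: comp_assoc[OF i1a B'(2,4)] B'(6) comp_ident_left[OF i1a])
  also have "\<dots> = q\<^sub>2 \<cdot> (?J \<cdot> s)" by (simp only: i1(2) Js comp_ident_right[OF C'(2)])
  also have "\<dots> = s" by (simp only: comp_assoc[OF s B'(2,4)] B'(6) comp_ident_left[OF s])
  finally show ?thesis using i1(1) unfolding inflation_def by blast
qed

end

section \<open>The equivalences\<close>

theorem proposition7p1:
  fixes C :: "('o, 'm, 'e, 'x) extri_scheme" (structure)
  assumes "extriangulated_category C"
  shows
    "(weakly_idempotent_complete C \<longleftrightarrow>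
        (\<forall>X Y Z f g. arrow C f X Y \<and> arrow C g Y Z \<and> inflation C X Z (g \<cdot> f)
          \<longrightarrow> inflation C X Y f)) \<and>
     (weakly_idempotent_complete C \<longleftrightarrow>
        (\<forall>X Y Z f g. arrow C f X Y \<and> arrow C g Y Z \<and> deflation C X Z (g \<cdot> f)
          \<longrightarrow> deflation C Y Z g)) \<and>
     (weakly_idempotent_complete C \<longleftrightarrow>
        (\<forall>A B f A' B' f'. inflation C A B f \<and> retract C A' B' f' A B f
          \<longrightarrow> inflation C A' B' f')) \<and>
     (weakly_idempotent_complete C \<longleftrightarrow>
        (\<forall>A B f A' B' f'. deflation C A B f \<and> retract C A' B' f' A B f
          \<longrightarrow> deflation C A' B' f')) \<and>
     (weakly_idempotent_complete C \<longleftrightarrow>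
        (\<forall>X Y Z i S j\<^sub>1 j\<^sub>2 q\<^sub>1 q\<^sub>2. arrow C i X Y \<and> biproduct C Y Z S j\<^sub>1 j\<^sub>2 q\<^sub>1 q\<^sub>2 \<and>
            inflation C X S (column_mor C X S j\<^sub>1 j\<^sub>2 i (zero_mor C X Z))
          \<longrightarrow> inflation C X Y i)) \<and>
     (weakly_idempotent_complete C \<longleftrightarrow>
        (\<forall>X Y Z p S j\<^sub>1 j\<^sub>2 q\<^sub>1 q\<^sub>2. arrow C p X Y \<and> biproduct C X Z S j\<^sub>1 j\<^sub>2 q\<^sub>1 q\<^sub>2 \<and>
            deflation C S Y (row_mor C S Y q\<^sub>1 q\<^sub>2 p (zero_mor C Z Y))
          \<longrightarrow> deflation C X Y p)) \<and>
     (weakly_idempotent_complete C \<longleftrightarrow>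
        (\<forall>A\<^sub>1 f\<^sub>A A\<^sub>2 g\<^sub>A A\<^sub>3 \<delta>\<^sub>A B\<^sub>1 f\<^sub>B B\<^sub>2 g\<^sub>B B\<^sub>3 \<delta>\<^sub>B i\<^sub>2 p\<^sub>2 C\<^sub>2 \<epsilon>\<^sub>2 i\<^sub>3 p\<^sub>3 C\<^sub>3 \<epsilon>\<^sub>3.
            etriangle C (A\<^sub>1, f\<^sub>A, A\<^sub>2, g\<^sub>A, A\<^sub>3, \<delta>\<^sub>A) \<and> etriangle C (B\<^sub>1, f\<^sub>B, B\<^sub>2, g\<^sub>B, B\<^sub>3, \<delta>\<^sub>B) \<and>
            etriangle C (A\<^sub>2, i\<^sub>2, B\<^sub>2, p\<^sub>2, C\<^sub>2, \<epsilon>\<^sub>2) \<and> etriangle C (A\<^sub>3, i\<^sub>3, B\<^sub>3, p\<^sub>3, C\<^sub>3, \<epsilon>\<^sub>3) \<and>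
            g\<^sub>B \<cdot> i\<^sub>2 = i\<^sub>3 \<cdot> g\<^sub>A
          \<longrightarrow> (\<exists>i\<^sub>1 p\<^sub>1 C\<^sub>1 \<epsilon>\<^sub>1 f\<^sub>C g\<^sub>C \<delta>\<^sub>C.
                three_by_three C (A\<^sub>1, f\<^sub>A, A\<^sub>2, g\<^sub>A, A\<^sub>3, \<delta>\<^sub>A) (B\<^sub>1, f\<^sub>B, B\<^sub>2, g\<^sub>B, B\<^sub>3, \<delta>\<^sub>B)
                  (C\<^sub>1, f\<^sub>C, C\<^sub>2, g\<^sub>C, C\<^sub>3, \<delta>\<^sub>C) (i\<^sub>1, p\<^sub>1, \<epsilon>\<^sub>1) (i\<^sub>2, p\<^sub>2, \<epsilon>\<^sub>2) (i\<^sub>3, p\<^sub>3, \<epsilon>\<^sub>3))))"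
    (is "(?wic \<longleftrightarrow> _) \<and> (_ \<longleftrightarrow> ?c2') \<and> _ \<and> (_ \<longleftrightarrow> ?c3') \<and> _ \<and> (_ \<longleftrightarrow> ?c4') \<and>
      (_ \<longleftrightarrow> ?c5)")
proof -
  interpret extriangulated_category C by fact
  interpret op: extriangulated_category "opposite C" by (rule op_ext)
  note op_wic = weakly_idempotent_complete_opposite
  have d2: "?wic \<longleftrightarrow> ?c2'"
    using op.wic_iff_inflation_left_cancel
    unfolding op_wic inflation_opposite opposite_simps by metis
  have d3: "?wic \<longleftrightarrow> ?c3'"
    using op.wic_iff_inflation_retract
    unfolding op_wic inflation_opposite retract_opposite by metis
  have d4: "?wic \<longleftrightarrow> ?c4'"
    using op.wic_iff_inflation_drop_zero
    unfolding op_wic inflation_opposite opposite_simps column_row_opposite biproduct_opposite by metis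
  have "?wic \<longleftrightarrow> ?c5"
  proof
    assume ?wic
    note cancel = this[unfolded wic_iff_inflation_left_cancel]
    show ?c5
      by (intro allI impI, elim conjE, rule three_by_three_lemma) (use cancel in blast)+
  next
    assume c5: ?c5
    show ?wic
    proof (rule wic_if_sections_inflations)
      fix X Y s r assume s: "arrow C s X Y" "arrow C r Y X" "r \<cdot>\<^bsub>C\<^esub> s = ident C X"
      show "inflation C X Y s"
        by (rule section_inflation_if_three_by_three[OF _ s]) (intro c5[rule_format] conjI)
    qed
  qed
  then show ?thesis
    using wic_iff_inflation_left_cancel wic_iff_inflation_retract wic_iff_inflation_drop_zero d2 d3 d4
    by blast
qed

end
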